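(* Let $n\geq 6$ be an integer such that $p=(2n-1)(2n+1)$, $q=(2n-1)(2n+3)$ and $r=(2n+1)(2n+3)$ are square-free integers, and let $K=\mathbb{Q}(\sqrt{p},\sqrt{q})$. If $\alpha\in\mathcal{O}_K^{+}$ is indecomposable in $\mathcal{O}_K$, then $N(\alpha)\leq 16n^4+64n^3+16n^2-96n+36$.
   Context: $\mathcal{O}_K$ is the ring of integers of $K$; $\mathcal{O}_K^{+}$ is the set of totally positive elements of $\mathcal{O}_K$ (all real embeddings positive). An element $\alpha\in\mathcal{O}_K^{+}$ is indecomposable if it cannot be written as $\beta+\gamma$ with $\beta,\gamma\in\mathcal{O}_K^{+}$. $N(\alpha)$ is the field norm (product of all conjugates). *)

theory Defs
  imports Complex_Main "HOL-Algebra.Algebraic_Closure_Type" "HOL-Algebra.Generated_Fields"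
    "HOL-Computational_Algebra.Squarefree" "HOL-Library.FuncSet"
begin

text \<open>
  Number fields are represented as subfields of the reals, given by their carrier sets.
  Real square roots being available, this fixes one real embedding of the field; the notions
  below quantify over all embeddings and so do not depend on that choice.
\<close>

text \<open>
  Since \<^const>\<open>generate_field\<close> contains 1 and is closed under the field operations, it contains
  the prime field \<open>\<rat>\<close>.
\<close>
definition rat_adjoin :: "real set \<Rightarrow> real set" where
  "rat_adjoin A = generate_field ring_of_type_algebra A"

text \<open>
  Embeddings are functions on the whole type, normalised outside \<open>K\<close> so that each field
  homomorphism \<open>K \<rightarrow> F\<close> is counted once. With target \<^typ>\<open>real\<close> these are the real embeddings
  of \<open>K\<close>, with target \<^typ>\<open>complex\<close> all its embeddings.
\<close>
definition field_embeddings :: "real set \<Rightarrow> (real \<Rightarrow> 'b::field) set" where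
  "field_embeddings K =
     ring_hom (ring_of_type_algebra\<lparr>carrier := K\<rparr>) ring_of_type_algebra \<inter> extensional K"

definition ring_of_integers :: "real set \<Rightarrow> real set" where
  "ring_of_integers K = {x \<in> K. algebraic_int x}"

definition totally_positive_integers :: "real set \<Rightarrow> real set" where
  "totally_positive_integers K =
     {x \<in> ring_of_integers K. \<forall>\<sigma> \<in> field_embeddings K. (\<sigma> x :: real) > 0}"

definition indecomposable :: "real set \<Rightarrow> real \<Rightarrow> bool" where
  "indecomposable K \<alpha> \<longleftrightarrow>
     \<alpha> \<in> totally_positive_integers K \<and>
     \<not> (\<exists>\<beta> \<in> totally_positive_integers K. \<exists>\<gamma> \<in> totally_positive_integers K. \<alpha> = \<beta> + \<gamma>)"

text \<open>
  The product of all conjugates. The real part loses nothing, by the lemma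
  \<open>prod_field_embeddings_real\<close> below.
\<close>
definition field_norm :: "real set \<Rightarrow> real \<Rightarrow> real" where
  "field_norm K x = Re (\<Prod>\<sigma> \<in> field_embeddings K. \<sigma> x)"

lemma cnj_field_embedding:
  assumes "subring K ring_of_type_algebra" "\<sigma> \<in> field_embeddings K"
  shows "restrict (cnj \<circ> \<sigma>) K \<in> field_embeddings K"
proof -
  have "x * y \<in> K \<and> x + y \<in> K" if "x \<in> K" "y \<in> K" for x y
    using subringE(6,7)[OF assms(1)] that by (auto simp: ring_of_type_algebra_def)
  moreover have "1 \<in> K"
    using subringE(3)[OF assms(1)] by (simp add: ring_of_type_algebra_def)
  ultimately show ?thesis
    using assms(2) by (auto simp: field_embeddings_def ring_hom_def ring_of_type_algebra_def)
qed

lemma prod_field_embeddings_real: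
  assumes "subring K ring_of_type_algebra" "x \<in> K"
  shows "(\<Prod>\<sigma> \<in> field_embeddings K. \<sigma> x) \<in> (\<real> :: complex set)"
proof -
  have "restrict (cnj \<circ> restrict (cnj \<circ> \<sigma>) K) K = \<sigma>" if "\<sigma> \<in> field_embeddings K" for \<sigma>
    using that by (auto simp: field_embeddings_def extensional_def restrict_def)
  then have "(\<Prod>\<sigma> \<in> field_embeddings K. cnj (\<sigma> x)) = (\<Prod>\<sigma> \<in> field_embeddings K. \<sigma> x)"
    using assms
    by (intro prod.reindex_bij_witness[where i = "\<lambda>\<sigma>. restrict (cnj \<circ> \<sigma>) K" and
          j = "\<lambda>\<sigma>. restrict (cnj \<circ> \<sigma>) K"]) (auto intro: cnj_field_embedding)
  then show ?thesis
    by (simp add: Reals_cnj_iff)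
qed

end

theory Submission
  imports Defs "HOL-Library.Product_Plus" "Jordan_Normal_Form.Char_Poly"
begin

text \<open>
  Write \<open>x, y, z\<close> for the square roots of \<open>2n-1, 2n+1, 2n+3\<close>. The unit \<open>\<eta> = (x+y)(y+z)/2\<close> has signature
  \<open>(+,+,-,-)\<close>, that of \<open>yz\<close>, so dividing by \<open>\<eta>\<close> turns totally positive integers into integers of
  that signature. There the facets of the convex hull of the integers, up to the units
  \<open>2n+xy\<close>, \<open>(2n+1+xz)/2\<close>, \<open>2n+2+yz\<close> and conjugation, are of two types: one is cut out by the
  coefficient of \<open>yz/2\<close> being 1, the other is a tetrahedron. Both functionals take positive integer
  values, so an orbit contains an element minimising them, and minimality against the neighbouring
  facets places that element in the cone over its facet. If the functional is at least 3 there, some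
  lattice point of the facet can be split off. If it is at most 2, the arithmetic-geometric mean
  inequality bounds the norm by \<open>((2n+1)(2n+3))\<^sup>2\<close>; the only points
  beyond \<open>((2n+1)(2n+3) - 9)\<^sup>2\<close> are \<open>yz + i\<close> with \<open>-2 \<le> i \<le> 2\<close>, and these decompose explicitly.
\<close>

section \<open>Sums and products of algebraic integers\<close>

text \<open>In the signature of yz the absolute values of the conjugates add up to 2yz times the
  integer m + k, so the functional to which the arithmetic-geometric mean inequality applies is
  integer-valued, with equality on multiples of yz. At value 2 it yields only r^2 with r =
  (2n+1)(2n+3), which yz attains. Averaging the conjugates in pairs refines this to (r - G/4)^2, and
  9 is G/4 for yz + 3, whose norm is exactly (r - 9)^2.

  Completeness of the list of facets is never proved. A counterexample minimising the smaller of the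
  two functionals among all counterexamples satisfies the inequalities of one of the two cones,
  since each of them compares that minimum with a functional at an image under the units. The units
  are totally positive of norm 1, so every such image is again a counterexample.\<close>

definition int_span :: "'a::comm_ring_1 set \<Rightarrow> 'a set" where
  "int_span S = {\<Sum>t\<in>S. of_int (c t) * t | c. True}"

lemma int_spanI: "(\<Sum>t\<in>S. of_int (c t) * t) \<in> int_span S"
  by (auto simp: int_span_def)

lemma int_span_base:
  assumes "finite S" "s \<in> S"
  shows "s \<in> int_span S"
proof -
  have "(\<Sum>t\<in>S. of_int (if t = s then 1 else 0) * t) = (\<Sum>t\<in>S. if t = s then s else 0)"
    by (intro sum.cong) auto
  also have "\<dots> = s" using assms by simp
  finally show ?thesis using int_spanI[of "\<lambda>t. if t = s then 1 else 0" S] by simp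
qed

lemma int_span_add:
  assumes "u \<in> int_span S" "v \<in> int_span S"
  shows "u + v \<in> int_span S"
proof -
  obtain c d where "u = (\<Sum>t\<in>S. of_int (c t) * t)" "v = (\<Sum>t\<in>S. of_int (d t) * t)"
    using assms by (auto simp: int_span_def)
  then have "u + v = (\<Sum>t\<in>S. of_int (c t + d t) * t)"
    by (simp add: sum.distrib distrib_right)
  then show ?thesis using int_spanI[of "\<lambda>t. c t + d t" S] by simp
qed

lemma int_span_scale:
  assumes "u \<in> int_span S"
  shows "of_int k * u \<in> int_span S"
proof -
  obtain c where "u = (\<Sum>t\<in>S. of_int (c t) * t)"
    using assms by (auto simp: int_span_def)
  then have "of_int k * u = (\<Sum>t\<in>S. of_int (k * c t) * t)"
    by (simp add: sum_distrib_left mult.assoc)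
  then show ?thesis using int_spanI[of "\<lambda>t. k * c t" S] by simp
qed

lemma int_span_sum:
  assumes "\<And>i. i \<in> I \<Longrightarrow> f i \<in> int_span S"
  shows "(\<Sum>i\<in>I. f i) \<in> int_span S"
  using assms
proof (induction I rule: infinite_finite_induct)
  case (insert i I)
  then show ?case by (simp add: int_span_add)
qed (use int_spanI[of "\<lambda>_. 0" S] in simp_all)

lemma int_span_mult:
  assumes "\<And>s. s \<in> S \<Longrightarrow> x * s \<in> int_span S" "u \<in> int_span S"
  shows "x * u \<in> int_span S"
proof -
  obtain c where "u = (\<Sum>t\<in>S. of_int (c t) * t)"
    using assms by (auto simp: int_span_def)
  then have "x * u = (\<Sum>t\<in>S. of_int (c t) * (x * t))"
    by (simp add: sum_distrib_left mult_ac)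
  then show ?thesis using assms(1) by (auto intro!: int_span_sum int_span_scale)
qed

text \<open>Determinant trick: the elements of \<open>S\<close> form an eigenvector, with eigenvalue
  \<open>x\<close>, of the integer matrix recording multiplication by \<open>x\<close>, and its
  characteristic polynomial is monic.\<close>

lemma algebraic_int_if_stable:
  fixes x :: "'a::field_char_0"
  assumes S: "finite S" "s \<in> S" "s \<noteq> 0" and stable: "\<And>t. t \<in> S \<Longrightarrow> x * t \<in> int_span S"
  shows "algebraic_int x"
proof -
  define N where "N = card S"
  obtain f where f: "bij_betw f {0..<N} S"
    using ex_bij_betw_nat_finite[OF S(1)] by (auto simp: N_def)
  have "\<exists>c. x * t = (\<Sum>u\<in>S. of_int (c u) * u)" if "t \<in> S" for t
    using stable[OF that] by (auto simp: int_span_def)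
  then obtain c where c: "x * t = (\<Sum>u\<in>S. of_int (c t u) * u)" if "t \<in> S" for t
    by metis
  define A :: "int mat" where "A = mat N N (\<lambda>(i, j). c (f i) (f j))"
  have A: "A \<in> carrier_mat N N" by (simp add: A_def)
  define B :: "'a mat" where "B = map_mat of_int A"
  have B: "B \<in> carrier_mat N N" using A by (simp add: B_def)
  have "eigenvector B (vec N f) x"
    unfolding eigenvector_def
  proof (intro conjI)
    show "vec N f \<in> carrier_vec (dim_row B)" using B by simp
    obtain i where i: "i < N" "f i = s" using f S(2) by (auto simp: bij_betw_def)
    show "vec N f \<noteq> 0\<^sub>v (dim_row B)"
    proof
      assume "vec N f = 0\<^sub>v (dim_row B)"
      then have "vec N f $ i = 0" using i B by simp
      then show False using i S(3) by simp
    qed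
    show "B *\<^sub>v vec N f = x \<cdot>\<^sub>v vec N f"
    proof (rule eq_vecI)
      fix i assume "i < dim_vec (x \<cdot>\<^sub>v vec N f)"
      then have i: "i < N" by simp
      then have "f i \<in> S" using f by (auto simp: bij_betw_def)
      have "(B *\<^sub>v vec N f) $ i = (\<Sum>j = 0..<N. of_int (c (f i) (f j)) * f j)"
        using i by (simp add: B_def A_def scalar_prod_def)
      also have "\<dots> = (\<Sum>u\<in>S. of_int (c (f i) u) * u)"
        by (rule sum.reindex_bij_betw[OF f])
      finally show "(B *\<^sub>v vec N f) $ i = (x \<cdot>\<^sub>v vec N f) $ i"
        using c[OF \<open>f i \<in> S\<close>] i by simp
    qed (use B in simp)
  qed
  then have "poly (char_poly B) x = 0"
    using eigenvalue_root_char_poly[OF B] by (auto simp: eigenvalue_def)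
  moreover have "char_poly B = map_poly of_int (char_poly A)"
    unfolding B_def by (rule of_int_hom.char_poly_hom[OF A])
  moreover have "lead_coeff (char_poly A) = 1"
    using degree_monic_char_poly[OF A] by simp
  ultimately show ?thesis unfolding algebraic_int_altdef_ipoly by metis
qed

lemma algebraic_int_power_reduction:
  fixes x :: "'a::field_char_0"
  assumes "algebraic_int x"
  obtains d :: nat and c :: "nat \<Rightarrow> int" where "0 < d" "x ^ d = (\<Sum>i<d. of_int (c i) * x ^ i)"
proof -
  obtain p where p: "poly (map_poly of_int p) x = 0" "lead_coeff p = 1"
    using assms by (auto simp: algebraic_int_altdef_ipoly)
  have "0 = (\<Sum>i\<le>degree p. of_int (coeff p i) * x ^ i)"
    using p(1) by (simp add: poly_altdef)
  also have "\<dots> = (\<Sum>i<degree p. of_int (coeff p i) * x ^ i) + x ^ degree p"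
    using p(2) by (simp add: lessThan_Suc_atMost[symmetric])
  finally have *: "x ^ degree p = (\<Sum>i<degree p. of_int (- coeff p i) * x ^ i)"
    by (simp add: sum_negf eq_neg_iff_add_eq_0 add.commute)
  moreover have "degree p \<noteq> 0"
    using * by (cases "degree p = 0") auto
  ultimately show ?thesis using that[of "degree p" "\<lambda>i. - coeff p i"] by simp
qed

text \<open>The monomials x^i y^j with exponents below the degrees of the two monic equations span
  Z[x, y]. A span stable under both x and y is stable under their sum and product.\<close>

lemma algebraic_int_pair_stable:
  fixes x y :: "'a::field_char_0"
  assumes "algebraic_int x" "algebraic_int y"
  obtains S where "finite S" "1 \<in> S" "\<And>t. t \<in> S \<Longrightarrow> x * t \<in> int_span S" "\<And>t. t \<in> S \<Longrightarrow> y * t \<in> int_span S"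
proof -
  obtain d c where d: "0 < d" "x ^ d = (\<Sum>i<d. of_int (c i :: int) * x ^ i)"
    using algebraic_int_power_reduction[OF assms(1)] by metis
  obtain e b where e: "0 < e" "y ^ e = (\<Sum>i<e. of_int (b i :: int) * y ^ i)"
    using algebraic_int_power_reduction[OF assms(2)] by metis
  define S where "S = (\<lambda>(i, j). x ^ i * y ^ j) ` ({..<d} \<times> {..<e})"
  have fin: "finite S" by (simp add: S_def)
  have base: "x ^ i * y ^ j \<in> int_span S" if "i < d" "j < e" for i j
    using that fin by (intro int_span_base) (auto simp: S_def)
  show ?thesis
  proof (rule that[OF fin])
    have "(\<lambda>(i, j). x ^ i * y ^ j) (0, 0) \<in> S"
      unfolding S_def using d(1) e(1) by (intro imageI) simp
    then show "1 \<in> S" by simp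
    fix t assume "t \<in> S"
    then obtain i j where ij: "i < d" "j < e" "t = x ^ i * y ^ j" by (auto simp: S_def)
    show "x * t \<in> int_span S"
    proof (cases "Suc i < d")
      case True
      then show ?thesis using base[of "Suc i" j] ij by (simp add: mult.assoc)
    next
      case False
      then have "Suc i = d" using ij by simp
      then have "x * t = x ^ d * y ^ j" using ij by (auto simp: mult.assoc)
      also have "\<dots> = (\<Sum>i<d. of_int (c i) * (x ^ i * y ^ j))"
        by (simp add: d(2) sum_distrib_right mult.assoc)
      also have "\<dots> \<in> int_span S" using base ij by (intro int_span_sum int_span_scale) auto
      finally show ?thesis .
    qed
    show "y * t \<in> int_span S"
    proof (cases "Suc j < e")
      case True
      then show ?thesis using base[of i "Suc j"] ij by (simp add: mult_ac)
    next
      case False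
      then have "Suc j = e" using ij by simp
      then have "y * t = x ^ i * y ^ e" using ij by (auto simp: mult_ac)
      also have "\<dots> = (\<Sum>j<e. of_int (b j) * (x ^ i * y ^ j))"
        by (simp add: e(2) sum_distrib_left mult_ac)
      also have "\<dots> \<in> int_span S" using base ij by (intro int_span_sum int_span_scale) auto
      finally show ?thesis .
    qed
  qed
qed

lemma algebraic_int_add:
  fixes x y :: "'a::field_char_0"
  assumes "algebraic_int x" "algebraic_int y"
  shows "algebraic_int (x + y)"
proof -
  obtain S where S: "finite S" "1 \<in> S" "\<And>t. t \<in> S \<Longrightarrow> x * t \<in> int_span S" "\<And>t. t \<in> S \<Longrightarrow> y * t \<in> int_span S"
    using algebraic_int_pair_stable[OF assms] by metis
  show ?thesis
    by (rule algebraic_int_if_stable[OF S(1,2)]) (auto simp: distrib_right intro: int_span_add S)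
qed

lemma algebraic_int_mult:
  fixes x y :: "'a::field_char_0"
  assumes "algebraic_int x" "algebraic_int y"
  shows "algebraic_int (x * y)"
proof -
  obtain S where S: "finite S" "1 \<in> S" "\<And>t. t \<in> S \<Longrightarrow> x * t \<in> int_span S" "\<And>t. t \<in> S \<Longrightarrow> y * t \<in> int_span S"
    using algebraic_int_pair_stable[OF assms] by metis
  show ?thesis
    by (rule algebraic_int_if_stable[OF S(1,2)]) (auto simp: mult.assoc intro: int_span_mult S)
qed

lemma algebraic_int_diff:
  fixes x y :: "'a::field_char_0"
  assumes "algebraic_int x" "algebraic_int y"
  shows "algebraic_int (x - y)"
  using algebraic_int_add[OF assms(1) algebraic_int_minus[OF assms(2)]] by simp

section \<open>The unit symmetries of the integer lattice\<close>

type_synonym quad = "int \<times> int \<times> int \<times> int"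

text \<open>
  \<open>(i, j, m, k)\<close> are the coordinates in the integral basis
  \<open>1, (x\<^sup>2 + xz)/2, (xy + yz)/2, (yz - xy)/2\<close>; the conjugates of an element arise by changing the
  signs of \<open>x, y, z\<close>.
\<close>
definition conj_val :: "real \<Rightarrow> real \<Rightarrow> real \<Rightarrow> quad \<Rightarrow> real" where
  "conj_val x y z = (\<lambda>(i, j, m, k).
     (2 * of_int i + of_int j * (x * x + x * z) + of_int m * (y * (x + z)) + of_int k * (y * (z - x))) / 2)"

definition quad_norm :: "real \<Rightarrow> real \<Rightarrow> real \<Rightarrow> quad \<Rightarrow> real" where
  "quad_norm x y z w =
     conj_val x y z w * conj_val (- x) y z w * conj_val x (- y) z w * conj_val x y (- z) w"

lemma conj_val_add: "conj_val x y z (v + w) = conj_val x y z v + conj_val x y z w"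
  by (cases v; cases w) (simp add: conj_val_def field_simps)

text \<open>
  Multiplication and division by the fundamental units \<open>2n+xy\<close>, \<open>(2n+1+xz)/2\<close>, \<open>2n+2+yz\<close>.
\<close>
fun mul_p :: "int \<Rightarrow> quad \<Rightarrow> quad" where
  "mul_p n (i, j, m, k) =
     (2*n*i - (2*n-1)*(2*n+1)*k, 2*n*j + (2*n+1)*(m+k), 2*n*m + i + (2*n-1)*j, 2*n*k - i)"

fun div_p :: "int \<Rightarrow> quad \<Rightarrow> quad" where
  "div_p n (i, j, m, k) =
     (2*n*i + (2*n-1)*(2*n+1)*k, 2*n*j - (2*n+1)*(m+k), 2*n*m - i - (2*n-1)*j, 2*n*k + i)"

fun mul_q :: "int \<Rightarrow> quad \<Rightarrow> quad" where
  "mul_q n (i, j, m, k) = (i + (2*n-1)*j, i + 2*n*j, (2*n+1)*m + k, - m)"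

fun div_q :: "int \<Rightarrow> quad \<Rightarrow> quad" where
  "div_q n (i, j, m, k) = (2*n*i - (2*n-1)*j, j - i, - k, (2*n+1)*k + m)"

fun mul_r :: "int \<Rightarrow> quad \<Rightarrow> quad" where
  "mul_r n (i, j, m, k) =
     ((2*n+2)*i + 2*(2*n+1)*m + (2*n+1)\<^sup>2*k, (2*n+2)*j + (2*n+1)*(m-k),
      (2*n+2)*m + i + (2*n+1)*j, (2*n+2)*k + i - 2*j)"

fun div_r :: "int \<Rightarrow> quad \<Rightarrow> quad" where
  "div_r n (i, j, m, k) =
     ((2*n+2)*i - 2*(2*n+1)*m - (2*n+1)\<^sup>2*k, (2*n+2)*j - (2*n+1)*(m-k),
      (2*n+2)*m - i - (2*n+1)*j, (2*n+2)*k - i + 2*j)"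

text \<open>Conjugation x -> -x: it exchanges the last two basis elements and sends (x^2 + xz)/2 to
  2n - 1 minus itself.\<close>

fun flip_x :: "int \<Rightarrow> quad \<Rightarrow> quad" where
  "flip_x n (i, j, m, k) = (i + (2*n-1)*j, - j, k, m)"

text \<open>Conjugation y -> -y exchanges the positive and the negative conjugates; the minus sign
  restores the signature of yz.\<close>

fun neg_flip_y :: "quad \<Rightarrow> quad" where
  "neg_flip_y (i, j, m, k) = (- i, - j, m, k)"

lemma quad_maps_inverse:
  "div_p n (mul_p n w) = w" "div_q n (mul_q n w) = w" "mul_q n (div_q n w) = w"
  "mul_r n (div_r n w) = w" "flip_x n (flip_x n w) = w" "neg_flip_y (neg_flip_y w) = w"
  by (cases w; simp add: algebra_simps power2_eq_square)+

lemma quad_maps_add: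
  "mul_p n (v + w) = mul_p n v + mul_p n w" "div_p n (v + w) = div_p n v + div_p n w"
  "mul_q n (v + w) = mul_q n v + mul_q n w" "div_q n (v + w) = div_q n v + div_q n w"
  "mul_r n (v + w) = mul_r n v + mul_r n w" "div_r n (v + w) = div_r n v + div_r n w"
  "flip_x n (v + w) = flip_x n v + flip_x n w" "neg_flip_y (v + w) = neg_flip_y v + neg_flip_y w"
  by (cases v; cases w; simp add: algebra_simps)+

lemma conj_val_neg_flip_y: "conj_val x y z (neg_flip_y w) = - conj_val x (- y) z w"
  by (cases w) (simp add: conj_val_def field_simps)

context
  fixes n :: int and x y z :: real
  assumes squares: "x * x = 2 * of_int n - 1" "y * y = 2 * of_int n + 1" "z * z = 2 * of_int n + 3"
begin

text \<open>The context fixes the squares of the roots but not their signs, so its rules can be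
  instantiated at every conjugate. The variants with a factor \<open>t\<close> reach squares inside
  right-nested products.\<close>

lemma square_rules:
  "x * x = 2 * of_int n - 1" "x * (x * t) = (2 * of_int n - 1) * t"
  "y * y = 2 * of_int n + 1" "y * (y * t) = (2 * of_int n + 1) * t"
  "z * z = 2 * of_int n + 3" "z * (z * t) = (2 * of_int n + 3) * t"
  by (simp_all add: squares flip: mult.assoc)

lemma conj_val_mul_p: "conj_val x y z (mul_p n w) = (2 * of_int n + x * y) * conj_val x y z w"
  by (cases w) (simp add: conj_val_def square_rules field_simps power2_eq_square)

lemma conj_val_div_p: "conj_val x y z (div_p n w) = (2 * of_int n - x * y) * conj_val x y z w"
  by (cases w) (simp add: conj_val_def square_rules field_simps power2_eq_square)

lemma conj_val_mul_q: "conj_val x y z (mul_q n w) = (2 * of_int n + 1 + x * z) / 2 * conj_val x y z w"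
  by (cases w) (simp add: conj_val_def square_rules field_simps power2_eq_square)

lemma conj_val_div_q: "conj_val x y z (div_q n w) = (2 * of_int n + 1 - x * z) / 2 * conj_val x y z w"
  by (cases w) (simp add: conj_val_def square_rules field_simps power2_eq_square)

lemma conj_val_mul_r: "conj_val x y z (mul_r n w) = (2 * of_int n + 2 + y * z) * conj_val x y z w"
  by (cases w) (simp add: conj_val_def square_rules field_simps power2_eq_square)

lemma conj_val_div_r: "conj_val x y z (div_r n w) = (2 * of_int n + 2 - y * z) * conj_val x y z w"
  by (cases w) (simp add: conj_val_def square_rules field_simps power2_eq_square)

lemma conj_val_flip_x: "conj_val x y z (flip_x n w) = conj_val (- x) y z w"
  by (cases w) (simp add: conj_val_def square_rules field_simps power2_eq_square)

end

lemma conj_val_uminus: "conj_val (- x) (- y) (- z) w = conj_val x y z w"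
  by (cases w) (simp add: conj_val_def algebra_simps)

section \<open>Descent in the cone over the two hexagons\<close>

text \<open>
  The points with \<open>m + k = 1\<close> form the convex hull of the hexagon with vertices \<open>(\<plusminus>1,0), \<plusminus>(1,1), (0,\<plusminus>1)\<close>
  in the \<open>(i,j)\<close>-plane at \<open>m = 1\<close> and its conjugate at \<open>k = 1\<close>; with \<open>N = 2n\<close> the slice of the cone
  at \<open>(m,k)\<close> is the Minkowski sum of \<open>m\<close> times the first and \<open>k\<close> times the second hexagon.
\<close>
fun in_cone :: "int \<Rightarrow> quad \<Rightarrow> bool" where
  "in_cone N (i, j, m, k) \<longleftrightarrow> 0 \<le> m \<and> 0 \<le> k \<and> \<bar>i\<bar> \<le> m + N * k \<and> \<bar>i - j\<bar> \<le> m + (N + 1) * k \<and>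
     \<bar>i + (N - 1) * j\<bar> \<le> N * m + k \<and> \<bar>i + N * j\<bar> \<le> (N + 1) * m + k"

text \<open>A vertex of the hexagon at m = 1 is split off. The bound on
  \<open>\<bar>j\<bar>\<close>, an edge direction common to both hexagons, is a hypothesis of its
  own, whereas the remainder only has to satisfy \<open>in_cone\<close>. The condition
  \<open>0 \<le> i + N * j\<close> selects one half under negation of i and j, and with it the three
  vertices to try. Subtracting (1,1) leaves i - j fixed while its bound drops by 1, so it fails only
  on the two extreme edges of i - j; there (1,0) or (0,1) moves i - j along with the bound.\<close>

lemma in_cone_descent:
  fixes N :: int
  assumes "1 \<le> N" "2 \<le> m" "in_cone N (i, j, m, k)" "\<bar>j\<bar> \<le> m + k" "0 \<le> i + N * j"
  shows "\<exists>s t. (s, t) \<in> {(1, 1), (0, 1), (1, 0)} \<and> in_cone N (i - s, j - t, m - 1, k)"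
proof -
  have k: "0 \<le> k" and i: "\<bar>i\<bar> \<le> m + N * k" and ij: "\<bar>i - j\<bar> \<le> m + (N + 1) * k"
    and C: "\<bar>i + (N - 1) * j\<bar> \<le> N * m + k" and D: "\<bar>i + N * j\<bar> \<le> (N + 1) * m + k"
    using assms by auto
  have Nk: "0 \<le> N * k" and Nm: "m - 1 \<le> N * (m - 1)" "m - 2 \<le> N * (m - 2)"
    using assms(1,2) k by (simp_all add: mult_le_cancel_right1)
  consider (upper) "i - j = m + (N + 1) * k" | (lower) "i - j = - (m + (N + 1) * k)"
    | (inner) "\<bar>i - j\<bar> \<le> m - 1 + (N + 1) * k"
    using ij by linarith
  then show ?thesis
  proof cases
    case upper
    \<comment> \<open>\<open>l\<close> is the position along the edge, counted from its vertex (m +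
      Nk, -k).\<close>
    define l where "l = j + k"
    have jl: "j = l - k" and il: "i = m + N * k + l"
      using upper by (simp_all add: l_def algebra_simps)
    have l0: "l \<le> 0" using i il by linarith
    have Nl: "N * l \<le> 0" using l0 assms(1) by (simp add: mult_nonneg_nonpos)
    have D0: "0 \<le> m + N * l + l" using assms(5) unfolding jl il by (simp add: algebra_simps)
    have "N * l \<le> l" using l0 assms(1) mult_right_mono_neg[of 1 N l] by simp
    then have l1: "1 - m \<le> l" using D0 assms(2) by linarith
    have "in_cone N (i - 1, j - 0, m - 1, k)"
      unfolding in_cone.simps jl il abs_le_iff
      by (intro conjI; insert assms(1,2) k Nk Nm Nl D0 l0 l1; simp only: ring_distribs mult_1 mult_1_right; linarith)
    then show ?thesis by blast
  next
    case lower
    define l where "l = j - k"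
    have jl: "j = l + k" and il: "i = l - m - N * k"
      using lower by (simp_all add: l_def algebra_simps)
    have lm: "l \<le> m" using assms(4) jl by linarith
    have D0: "0 \<le> N * l + l - m" using assms(5) unfolding jl il by (simp add: algebra_simps)
    have l1: "1 \<le> l"
    proof (rule ccontr)
      assume "\<not> 1 \<le> l"
      then have "N * l \<le> 0" using assms(1) by (simp add: mult_nonneg_nonpos)
      then show False using D0 assms(2) \<open>\<not> 1 \<le> l\<close> by linarith
    qed
    have Nl: "N * l \<le> N * m" "N \<le> N * l"
      using lm l1 assms(1) by simp_all
    have "in_cone N (i - 0, j - 1, m - 1, k)"
      unfolding in_cone.simps jl il abs_le_iff
      by (intro conjI; insert assms(1,2) k Nk Nm Nl D0 lm l1; simp only: ring_distribs mult_1 mult_1_right; linarith)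
    then show ?thesis by blast
  next
    case inner
    \<comment> \<open>Subtracting (1,1) lowers i while the lower bound on i rises by 1, so a slack
      of 2 is required. Likewise i + (N-1)j needs a slack of 2N in \<open>C_low\<close>. Both come
      from \<open>0 \<le> i + N * j\<close>.\<close>
    have i_low: "2 - m - N * k \<le> i"
    proof (rule ccontr)
      assume a: "\<not> 2 - m - N * k \<le> i"
      then have "j \<le> k" using inner by (simp add: algebra_simps abs_le_iff)
      then have "N * j \<le> N * k" using assms(1) by simp
      then show False using a assms(2,5) by linarith
    qed
    have C_low: "- N * (m - 2) - k \<le> i + (N - 1) * j"
    proof (rule ccontr)
      assume a: "\<not> - N * (m - 2) - k \<le> i + (N - 1) * j"
      then have "i + (N - 1) * j < - k"
        using Nm(2) assms(2) by (simp add: algebra_simps)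
      then have "k + 1 \<le> j" using assms(5) by (simp add: algebra_simps)
      then have "N * (k + 1) \<le> N * j" using assms(1) by simp
      then show False using a inner Nm(2) assms(1) by (simp add: algebra_simps abs_le_iff)
    qed
    have "in_cone N (i - 1, j - 1, m - 1, k)"
      unfolding in_cone.simps abs_le_iff
      by (intro conjI; insert assms(1,2,5) k Nk Nm i_low C_low inner i C D; simp only: ring_distribs mult_1 mult_1_right abs_le_iff; linarith)
    then show ?thesis by blast
  qed
qed

section \<open>The twisted signature and its symmetries\<close>

locale consecutive_roots =
  fixes n :: int and x y z :: real
  assumes n_ge: "6 \<le> n"
    and pos: "0 < x" "0 < y" "0 < z"
    and squares: "x * x = 2 * of_int n - 1" "y * y = 2 * of_int n + 1" "z * z = 2 * of_int n + 3"
begin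

lemma less: "x < y" "y < z" "x < z"
proof -
  have "x\<^sup>2 < y\<^sup>2" "y\<^sup>2 < z\<^sup>2"
    by (simp_all add: power2_eq_square squares)
  then show "x < y" "y < z"
    using pos by (simp_all add: power2_less_imp_less)
  then show "x < z" by simp
qed

lemma unit_p: "(2 * of_int n + x * y) * (2 * of_int n - x * y) = 1"
  and unit_q: "(2 * of_int n + 1 + x * z) / 2 * ((2 * of_int n + 1 - x * z) / 2) = 1"
  and unit_r: "(2 * of_int n + 2 + y * z) * (2 * of_int n + 2 - y * z) = 1"
  by (simp_all add: square_rules[OF squares] field_simps)

text \<open>Each unit is positive and has norm 1 in its quadratic field, so its conjugate is
  positive as well.\<close>

lemma units_pos:
  "0 < 2 * of_int n + x * y" "0 < 2 * of_int n - x * y"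
  "0 < (2 * of_int n + 1 + x * z) / 2" "0 < (2 * of_int n + 1 - x * z) / 2"
  "0 < 2 * of_int n + 2 + y * z" "0 < 2 * of_int n + 2 - y * z"
proof -
  have *: "0 < v" if "u * v = 1" "0 < u" for u v :: real
    using zero_less_mult_pos[of u v] that by simp
  have "0 < x * y" "0 < x * z" "0 < y * z" "0 < real_of_int n"
    using pos n_ge by simp_all
  then show p: "0 < 2 * of_int n + x * y" and q: "0 < (2 * of_int n + 1 + x * z) / 2"
    and r: "0 < 2 * of_int n + 2 + y * z"
    by simp_all
  show "0 < 2 * of_int n - x * y" "0 < (2 * of_int n + 1 - x * z) / 2" "0 < 2 * of_int n + 2 - y * z"
    using *[OF unit_p p] *[OF unit_q q] *[OF unit_r r] .
qed

definition sig_pos :: "quad \<Rightarrow> bool" where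
  "sig_pos w \<longleftrightarrow> 0 < conj_val x y z w \<and> 0 < conj_val (- x) y z w \<and>
     conj_val x (- y) z w < 0 \<and> conj_val x y (- z) w < 0"

definition sig_indec :: "quad \<Rightarrow> bool" where
  "sig_indec w \<longleftrightarrow> sig_pos w \<and> \<not> (\<exists>u v. sig_pos u \<and> sig_pos v \<and> w = u + v)"

text \<open>Changing all three signs has no effect, so changing two amounts to changing the third.
  This brings composed conjugations back to the four that occur in \<open>sig_pos\<close>.\<close>

lemma conj_val_flip_swap: "conj_val (- x) (- y) z w = conj_val x y (- z) w"
    "conj_val (- x) y (- z) w = conj_val x (- y) z w" "conj_val x (- y) (- z) w = conj_val (- x) y z w"
  using conj_val_uminus[of x y "- z" w] conj_val_uminus[of x "- y" z w] conj_val_uminus[of "- x" y z w]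
  by simp_all

lemma squares_neg:
  "(- x) * (- x) = 2 * of_int n - 1" "(- y) * (- y) = 2 * of_int n + 1" "(- z) * (- z) = 2 * of_int n + 3"
  by (simp_all add: squares)

lemmas mul_p_signs = conj_val_mul_p[OF squares] conj_val_mul_p[OF squares_neg(1) squares(2,3)]
  conj_val_mul_p[OF squares(1) squares_neg(2) squares(3)] conj_val_mul_p[OF squares(1,2) squares_neg(3)]

lemmas div_p_signs = conj_val_div_p[OF squares] conj_val_div_p[OF squares_neg(1) squares(2,3)]
  conj_val_div_p[OF squares(1) squares_neg(2) squares(3)] conj_val_div_p[OF squares(1,2) squares_neg(3)]

lemmas mul_q_signs = conj_val_mul_q[OF squares] conj_val_mul_q[OF squares_neg(1) squares(2,3)]
  conj_val_mul_q[OF squares(1) squares_neg(2) squares(3)] conj_val_mul_q[OF squares(1,2) squares_neg(3)]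

lemmas div_q_signs = conj_val_div_q[OF squares] conj_val_div_q[OF squares_neg(1) squares(2,3)]
  conj_val_div_q[OF squares(1) squares_neg(2) squares(3)] conj_val_div_q[OF squares(1,2) squares_neg(3)]

lemmas mul_r_signs = conj_val_mul_r[OF squares] conj_val_mul_r[OF squares_neg(1) squares(2,3)]
  conj_val_mul_r[OF squares(1) squares_neg(2) squares(3)] conj_val_mul_r[OF squares(1,2) squares_neg(3)]

lemmas div_r_signs = conj_val_div_r[OF squares] conj_val_div_r[OF squares_neg(1) squares(2,3)]
  conj_val_div_r[OF squares(1) squares_neg(2) squares(3)] conj_val_div_r[OF squares(1,2) squares_neg(3)]

lemmas flip_x_signs = conj_val_flip_x[OF squares] conj_val_flip_x[OF squares_neg(1) squares(2,3)]
  conj_val_flip_x[OF squares(1) squares_neg(2) squares(3)] conj_val_flip_x[OF squares(1,2) squares_neg(3)]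

lemmas conj_val_signs = mul_p_signs div_p_signs mul_q_signs div_q_signs mul_r_signs div_r_signs
  flip_x_signs conj_val_neg_flip_y conj_val_flip_swap

lemma sig_pos_maps:
  "sig_pos (mul_p n w) \<longleftrightarrow> sig_pos w" "sig_pos (div_p n w) \<longleftrightarrow> sig_pos w"
  "sig_pos (mul_q n w) \<longleftrightarrow> sig_pos w" "sig_pos (div_q n w) \<longleftrightarrow> sig_pos w"
  "sig_pos (mul_r n w) \<longleftrightarrow> sig_pos w" "sig_pos (div_r n w) \<longleftrightarrow> sig_pos w"
  "sig_pos (flip_x n w) \<longleftrightarrow> sig_pos w" "sig_pos (neg_flip_y w) \<longleftrightarrow> sig_pos w"
  using units_pos
  by (auto simp: sig_pos_def conj_val_signs zero_less_mult_iff mult_less_0_iff)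

text \<open>Each unit lies in a quadratic subfield, so among its four conjugates the unit and its
  inverse occur twice each.\<close>

lemma quad_norm_maps:
  "quad_norm x y z (mul_p n w) = quad_norm x y z w" "quad_norm x y z (div_q n w) = quad_norm x y z w"
  "quad_norm x y z (div_r n w) = quad_norm x y z w" "quad_norm x y z (flip_x n w) = quad_norm x y z w"
  "quad_norm x y z (neg_flip_y w) = quad_norm x y z w"
proof -
  have *: "(s * A) * (t * B) * (u * C) * (v * D) = (s * t * u * v) * (A * B * C * D)"
    for s t u v A B C D :: real
    by simp
  have one: "s * t * t * s = 1" "t * s * t * s = 1" "t * t * s * s = 1" if "s * t = 1" for s t :: real
  proof -
    have "s * t * (s * t) = 1" using that by simp
    then show "s * t * t * s = 1" "t * s * t * s = 1" "t * t * s * s = 1" by (simp_all only: mult_ac)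
  qed
  \<comment> \<open>The signs are left exactly as the conjugate instances produce them, so that
    unfolding can match these products.\<close>
  have p: "(2 * of_int n + x * y) * (2 * of_int n + - x * y) * (2 * of_int n + x * - y) * (2 * of_int n + x * y) = 1"
    using one(1)[OF unit_p] by simp
  have q: "(2 * of_int n + 1 - x * z) / 2 * ((2 * of_int n + 1 - - x * z) / 2) *
      ((2 * of_int n + 1 - x * z) / 2) * ((2 * of_int n + 1 - x * - z) / 2) = 1"
    using one(2)[OF unit_q] by simp
  have r: "(2 * of_int n + 2 - y * z) * (2 * of_int n + 2 - y * z) *
      (2 * of_int n + 2 - - y * z) * (2 * of_int n + 2 - y * - z) = 1"
    using one(3)[OF unit_r] by simp
  show "quad_norm x y z (mul_p n w) = quad_norm x y z w"
    unfolding quad_norm_def mul_p_signs * p by simp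
  show "quad_norm x y z (div_q n w) = quad_norm x y z w"
    unfolding quad_norm_def div_q_signs * q by simp
  show "quad_norm x y z (div_r n w) = quad_norm x y z w"
    unfolding quad_norm_def div_r_signs * r by simp
  show "quad_norm x y z (flip_x n w) = quad_norm x y z w"
    by (simp add: quad_norm_def flip_x_signs conj_val_flip_swap)
  show "quad_norm x y z (neg_flip_y w) = quad_norm x y z w"
    by (simp add: quad_norm_def conj_val_neg_flip_y conj_val_flip_swap)
qed

end

section \<open>Cone decomposition and norm bounds\<close>

text \<open>Averaging only within pairs keeps information on the element that the mean of all four
  conjugates loses; this is what isolates the points near yz.\<close>

lemma prod_le_square_halfsums:
  fixes s t u v :: real
  assumes "0 < s" "0 < t" "0 < u" "0 < v"
  shows "s * t * u * v \<le> ((s + t) * (u + v) / 4)\<^sup>2"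
proof -
  have am: "s * t \<le> ((s + t) / 2)\<^sup>2" for s t :: real
    using zero_le_power2[of "s - t"] by (simp add: power2_eq_square field_simps)
  have "(s * t) * (u * v) \<le> ((s + t) / 2)\<^sup>2 * ((u + v) / 2)\<^sup>2"
    using assms by (intro mult_mono am) auto
  also have "\<dots> = ((s + t) * (u + v) / 4)\<^sup>2"
    by (simp add: power2_eq_square)
  finally show ?thesis by (simp add: mult.assoc)
qed

lemma arith_geo_mean4:
  fixes s t u v :: real
  assumes "0 < s" "0 < t" "0 < u" "0 < v"
  shows "s * t * u * v \<le> ((s + t + u + v) / 4) ^ 4"
proof -
  have "(s + t) * (u + v) / 4 \<le> ((s + t + u + v) / 4)\<^sup>2"
    using zero_le_power2[of "(s + t) - (u + v)"] by (simp add: power2_eq_square field_simps)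
  then have "((s + t) * (u + v) / 4)\<^sup>2 \<le> (((s + t + u + v) / 4)\<^sup>2)\<^sup>2"
    using assms by (intro power_mono) auto
  then show ?thesis
    using prod_le_square_halfsums[OF assms] by (simp flip: power_mult)
qed

lemma combination_pos:
  fixes A B C D :: real
  assumes "0 \<le> A" "0 \<le> B" "0 \<le> C" "0 \<le> D" "0 < A + B + C + D" "0 < s" "0 < t" "0 < u" "0 < v"
  shows "0 < A * s + B * t + C * u + D * v"
proof -
  have nn: "0 \<le> A * s" "0 \<le> B * t" "0 \<le> C * u" "0 \<le> D * v"
    using assms by simp_all
  consider "0 < A" | "0 < B" | "0 < C" | "0 < D" using assms(1-5) by linarith
  then show ?thesis
  proof cases
    case 1 then have "0 < A * s" using assms by simp
    then show ?thesis using nn by linarith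
  next
    case 2 then have "0 < B * t" using assms by simp
    then show ?thesis using nn by linarith
  next
    case 3 then have "0 < C * u" using assms by simp
    then show ?thesis using nn by linarith
  next
    case 4 then have "0 < D * v" using assms by simp
    then show ?thesis using nn by linarith
  qed
qed

fun height :: "quad \<Rightarrow> int" where
  "height (i, j, m, k) = m + k"

text \<open>
  Equal to 1 on the vertices \<open>(2n,-1,0,1), (1,1,1,0), (1,0,1,0), (2n,2n+1,2n+1,-1)\<close> of the
  tetrahedral facet. The linear forms in the hypotheses of \<open>tetra_sig_pos\<close> are \<open>2n-1\<close> times the
  barycentric coordinates.
\<close>
fun tetra_height :: "int \<Rightarrow> quad \<Rightarrow> int" where
  "tetra_height n (i, j, m, k) = 2 * m + (2*n+1) * k - i"

context consecutive_roots
begin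

text \<open>The conjugates are half of P + R, Q + S, P - R and Q - S, so the claim is |P| < R and
  |Q| < S. Since (x^2 + xz)/2 = 2n - 1 + e with 0 < e < 1, P/2 and Q/2 are convex combinations of
  the linear forms bounded in \<open>in_cone\<close>, and the combined bounds stay below R/2 and
  S/2.\<close>

lemma in_cone_sig_pos:
  assumes "in_cone (2*n) (i, j, m, k)" "0 < m + k"
  shows "sig_pos (i, j, m, k)"
proof -
  define e where "e = (x * z - x * x) / 2"
  have "0 < x * (z - x)" using pos less by simp
  then have e0: "0 < e" by (simp add: e_def algebra_simps)
  have "x * z < y * y" using units_pos(4) squares by simp
  then have e1: "e < 1" using squares by (simp add: e_def)
  have xz: "x * z = 2 * of_int n - 1 + 2 * e" using squares by (simp add: e_def field_simps)
  \<comment> \<open>Expanded, this is y(x + z) > y^2 + xz = 2(2n + e).\<close>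
  have "0 < (y - x) * (z - y)" using less by simp
  then have A: "2 * (2 * of_int n + e) < y * (x + z)"
    using squares xz by (simp add: algebra_simps)
  have B: "2 < y * (z - x)"
  proof -
    have "(x + z)\<^sup>2 = 2 * (y * y + x * z)" using squares by (simp add: power2_eq_square algebra_simps)
    also have "\<dots> < (2 * y)\<^sup>2" using \<open>x * z < y * y\<close> by (simp add: power2_eq_square)
    finally have "x + z < 2 * y" by (rule power2_less_imp_less) (use pos in simp)
    then have "(x + z) * (z - x) < 2 * y * (z - x)" using less by simp
    moreover have "(x + z) * (z - x) = 4" using squares by (simp add: algebra_simps)
    ultimately show ?thesis by simp
  qed
  have convex: "\<bar>(1 - e) * s + e * t\<bar> \<le> (1 - e) * S + e * T" if "\<bar>s\<bar> \<le> S" "\<bar>t\<bar> \<le> T" for s t S T :: real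
  proof -
    have "\<bar>(1 - e) * s + e * t\<bar> \<le> (1 - e) * \<bar>s\<bar> + e * \<bar>t\<bar>"
      using abs_triangle_ineq[of "(1 - e) * s" "e * t"] e0 e1 by (simp add: abs_mult)
    also have "\<dots> \<le> (1 - e) * S + e * T"
      using that e0 e1 by (intro add_mono mult_left_mono) auto
    finally show ?thesis .
  qed
  have cone: "0 \<le> m" "0 \<le> k" "\<bar>i\<bar> \<le> m + 2*n * k" "\<bar>i - j\<bar> \<le> m + (2*n + 1) * k"
    "\<bar>i + (2*n - 1) * j\<bar> \<le> 2*n * m + k" "\<bar>i + 2*n * j\<bar> \<le> (2*n + 1) * m + k"
    using assms by simp_all
  have "real_of_int \<bar>i\<bar> \<le> real_of_int (m + 2*n * k)" "real_of_int \<bar>i - j\<bar> \<le> real_of_int (m + (2*n + 1) * k)"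
    "real_of_int \<bar>i + (2*n - 1) * j\<bar> \<le> real_of_int (2*n * m + k)"
    "real_of_int \<bar>i + 2*n * j\<bar> \<le> real_of_int ((2*n + 1) * m + k)"
    unfolding of_int_le_iff by (fact cone)+
  then have real_cone: "\<bar>real_of_int i\<bar> \<le> m + 2*n * k" "\<bar>real_of_int i - j\<bar> \<le> m + (2*n + 1) * k"
    "\<bar>i + (2*n - 1) * real_of_int j\<bar> \<le> 2*n * m + k" "\<bar>i + 2*n * real_of_int j\<bar> \<le> (2*n + 1) * m + k"
    by simp_all
  define P Q where "P = 2 * of_int i + of_int j * (x * x + x * z)"
    and "Q = 2 * of_int i + of_int j * (x * x - x * z)"
  define R S where "R = of_int m * (y * (x + z)) + of_int k * (y * (z - x))"
    and "S = of_int m * (y * (z - x)) + of_int k * (y * (x + z))"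
  have "P = 2 * ((1 - e) * (i + (2*n - 1) * real_of_int j) + e * (i + 2*n * real_of_int j))"
    unfolding P_def xz squares(1) by (simp add: algebra_simps)
  then have P: "\<bar>P\<bar> \<le> m * (2 * (2 * of_int n + e)) + k * 2"
    using convex[OF real_cone(3,4)] by (simp add: algebra_simps abs_mult)
  have "Q = 2 * ((1 - e) * real_of_int i + e * (real_of_int i - j))"
    unfolding Q_def xz squares(1) by (simp add: algebra_simps)
  then have Q: "\<bar>Q\<bar> \<le> m * 2 + k * (2 * (2 * of_int n + e))"
    using convex[OF real_cone(1,2)] by (simp add: algebra_simps abs_mult)
  have mono: "m * s + k * t < m * s' + k * t'" if "s < s'" "t < t'" for s t s' t' :: real
  proof (cases "m = 0")
    case True
    then show ?thesis using that assms(2) by simp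
  next
    case False
    then have "m * s < m * s'" "k * t \<le> k * t'" using that cone(1,2) by (simp_all add: mult_left_mono)
    then show ?thesis by simp
  qed
  have "\<bar>P\<bar> < R" using P mono[OF A B] by (simp add: R_def)
  have "\<bar>Q\<bar> < S" using Q mono[OF B A] by (simp add: S_def)
  have "conj_val x y z (i, j, m, k) = (P + R) / 2" "conj_val (- x) y z (i, j, m, k) = (Q + S) / 2"
    "conj_val x (- y) z (i, j, m, k) = (P - R) / 2" "conj_val x y (- z) (i, j, m, k) = (Q - S) / 2"
    by (simp_all add: conj_val_def P_def Q_def R_def S_def algebra_simps)
  then show ?thesis
    using \<open>\<bar>P\<bar> < R\<close> \<open>\<bar>Q\<bar> < S\<close> by (simp add: sig_pos_def) linarith
qed

text \<open>Times 2n - 1, the element is a nonnegative combination of the four vertices. The last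
  vertex has k = -1 and lies outside the cone over the hexagons; it gets its signature as the image
  of (1,1,1,0) under \<open>mul_q\<close>.\<close>

lemma tetra_sig_pos:
  assumes "0 \<le> i - m - k" "0 \<le> (2*n-1)*j - 2*n*i + 2*n*m + (4*n\<^sup>2+2*n-1)*k"
    "0 \<le> 2*n*m + k - i - (2*n-1)*j" "0 \<le> i - m - 2*n*k" "0 < tetra_height n (i, j, m, k)"
  shows "sig_pos (i, j, m, k)"
proof -
  define A B C D :: real where "A = of_int (i - m - k)"
    and "B = of_int ((2*n-1)*j - 2*n*i + 2*n*m + (4*n\<^sup>2+2*n-1)*k)"
    and "C = of_int (2*n*m + k - i - (2*n-1)*j)" and "D = of_int (i - m - 2*n*k)"
  have a: "0 < 2 * real_of_int n - 1" using n_ge by simp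
  have "0 < (2*n-1) * tetra_height n (i, j, m, k)" using n_ge assms(5) by simp
  also have "(2*n-1) * tetra_height n (i, j, m, k) = (i - m - k) +
      ((2*n-1)*j - 2*n*i + 2*n*m + (4*n\<^sup>2+2*n-1)*k) + (2*n*m + k - i - (2*n-1)*j) + (i - m - 2*n*k)"
    by (simp add: algebra_simps power2_eq_square)
  finally have "0 < A + B + C + D" unfolding A_def B_def C_def D_def by linarith
  moreover have "0 \<le> A" "0 \<le> B" "0 \<le> C" "0 \<le> D"
    using assms unfolding A_def B_def C_def D_def by linarith+
  ultimately have comb: "0 < A * s + B * t + C * u + D * v" if "0 < s" "0 < t" "0 < u" "0 < v" for s t u v
    using combination_pos that by blast
  \<comment> \<open>The roots are quantified afresh, so the identity serves all conjugates.\<close>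
  have lin: "(2 * of_int n - 1) * conj_val x y z (i, j, m, k) =
      A * conj_val x y z (2*n, -1, 0, 1) + B * conj_val x y z (1, 1, 1, 0) +
      C * conj_val x y z (1, 0, 1, 0) + D * conj_val x y z (2*n, 2*n+1, 2*n+1, -1)" for x y z :: real
  proof -
    define p q r where "p = (x * x + x * z) / 2" and "q = y * (x + z) / 2" and "r = y * (z - x) / 2"
    have "conj_val x y z (i, j, m, k) = of_int i + of_int j * p + of_int m * q + of_int k * r" for i j m k
      by (simp add: conj_val_def p_def q_def r_def add_divide_distrib)
    then show ?thesis
      by (simp add: A_def B_def C_def D_def algebra_simps power2_eq_square)
  qed
  have v: "sig_pos (1, 1, 1, 0)"
    by (rule in_cone_sig_pos) (use n_ge in simp_all)
  moreover have "sig_pos (1, 0, 1, 0)"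
    by (rule in_cone_sig_pos) (use n_ge in simp_all)
  moreover have "sig_pos (2*n, -1, 0, 1)"
    by (rule in_cone_sig_pos) (use n_ge in simp_all)
  moreover have "sig_pos (2*n, 2*n+1, 2*n+1, -1)"
    using v sig_pos_maps(3)[of "(1, 1, 1, 0)"] by (simp add: add.commute)
  moreover have "0 < conj_val s t u (i, j, m, k)"
    if "0 < conj_val s t u (2*n, -1, 0, 1)" "0 < conj_val s t u (1, 1, 1, 0)"
      "0 < conj_val s t u (1, 0, 1, 0)" "0 < conj_val s t u (2*n, 2*n+1, 2*n+1, -1)" for s t u
    using zero_less_mult_pos[OF comb[OF that, folded lin] a] .
  moreover have "conj_val s t u (i, j, m, k) < 0"
    if "conj_val s t u (2*n, -1, 0, 1) < 0" "conj_val s t u (1, 1, 1, 0) < 0"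
      "conj_val s t u (1, 0, 1, 0) < 0" "conj_val s t u (2*n, 2*n+1, 2*n+1, -1) < 0" for s t u
  proof -
    have "0 < (2 * of_int n - 1) * - conj_val s t u (i, j, m, k)"
      unfolding mult_minus_right lin using comb[OF that[folded neg_0_less_iff_less]] by linarith
    from zero_less_mult_pos[OF this a] show ?thesis by simp
  qed
  ultimately show ?thesis
    unfolding sig_pos_def by blast
qed

text \<open>The height is a trace up to signs: the absolute values of the conjugates add up to 2yz
  times it.\<close>

lemma height_pos:
  assumes "sig_pos w"
  shows "0 < height w"
proof (cases w)
  case (fields i j m k)
  have "conj_val x y z w + conj_val (- x) y z w - conj_val x (- y) z w - conj_val x y (- z) w =
      2 * (y * z) * of_int (height w)"
    by (simp add: fields conj_val_def field_simps)
  moreover have "0 < y * z" using pos by simp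
  ultimately show ?thesis
    using assms unfolding sig_pos_def by (smt (verit) mult_nonneg_nonpos of_int_le_0_iff)
qed

lemma quad_norm_le_height:
  assumes "sig_pos w"
  shows "quad_norm x y z w \<le> (of_int (height w) / 2) ^ 4 * ((2 * of_int n + 1) * (2 * of_int n + 3))\<^sup>2"
proof (cases w)
  case (fields i j m k)
  have "conj_val x y z w + conj_val (- x) y z w + - conj_val x (- y) z w + - conj_val x y (- z) w =
      2 * (y * z) * of_int (height w)"
    by (simp add: fields conj_val_def field_simps)
  moreover have "quad_norm x y z w \<le>
      ((conj_val x y z w + conj_val (- x) y z w + - conj_val x (- y) z w + - conj_val x y (- z) w) / 4) ^ 4"
    using arith_geo_mean4[of "conj_val x y z w" "conj_val (- x) y z w" "- conj_val x (- y) z w" "- conj_val x y (- z) w"]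
      assms by (simp add: sig_pos_def quad_norm_def)
  ultimately have "quad_norm x y z w \<le> (2 * (y * z) * of_int (height w) / 4) ^ 4"
    by simp
  also have "\<dots> = (of_int (height w) / 2) ^ 4 * ((y * y) * (z * z))\<^sup>2"
    by (simp add: power2_eq_square power4_eq_xxxx field_simps)
  finally show ?thesis by (simp only: squares)
qed

text \<open>Weighting the conjugates by (z-x)(z-y) and its sign variants makes their absolute values
  add up to 4yz times \<open>tetra_height\<close>. The product of the four weights is (4 * 2)^2 =
  64.\<close>

lemma tetra_height_bounds:
  assumes "sig_pos w"
  shows "0 < tetra_height n w"
    and "quad_norm x y z w \<le> of_int (tetra_height n w) ^ 4 * ((2 * of_int n + 1) * (2 * of_int n + 3))\<^sup>2 / 64"
proof -
  define A B C D where "A = (z - x) * (z - y) * conj_val x y z w"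
    and "B = (z + x) * (z - y) * conj_val (- x) y z w"
    and "C = (z - x) * (z + y) * - conj_val x (- y) z w"
    and "D = (z + x) * (z + y) * - conj_val x y (- z) w"
  have *: "0 < A" "0 < B" "0 < C" "0 < D"
    using assms pos less unfolding A_def B_def C_def D_def sig_pos_def
    by (intro mult_pos_pos; simp)+
  have sum: "A + B + C + D = 4 * (y * z) * of_int (tetra_height n w)"
    by (cases w) (simp add: A_def B_def C_def D_def conj_val_def field_simps square_rules[OF squares])
  have yz: "0 < y * z" using pos by simp
  show "0 < tetra_height n w"
  proof (rule ccontr)
    assume "\<not> 0 < tetra_height n w"
    then have "4 * (y * z) * of_int (tetra_height n w) \<le> 0"
      using yz by (simp add: mult_nonneg_nonpos)
    then show False using sum * by linarith
  qed
  have "64 * quad_norm x y z w = A * B * C * D"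
  proof -
    have "A * B * C * D = ((z - x) * (z + x))\<^sup>2 * ((z - y) * (z + y))\<^sup>2 * quad_norm x y z w"
      unfolding A_def B_def C_def D_def quad_norm_def by (simp add: power2_eq_square mult_ac)
    moreover have "(z - x) * (z + x) = 4" "(z - y) * (z + y) = 2"
      by (simp_all add: squares algebra_simps)
    ultimately show ?thesis by simp
  qed
  also have "\<dots> \<le> ((y * z) * of_int (tetra_height n w)) ^ 4"
    using arith_geo_mean4[OF *] by (simp add: sum mult.assoc)
  also have "\<dots> = of_int (tetra_height n w) ^ 4 * ((y * y) * (z * z))\<^sup>2"
    by (simp add: power_mult_distrib power2_eq_square power4_eq_xxxx)
  finally show "quad_norm x y z w \<le> of_int (tetra_height n w) ^ 4 * ((2 * of_int n + 1) * (2 * of_int n + 3))\<^sup>2 / 64"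
    by (simp add: squares)
qed

abbreviation norm_bound :: real where
  "norm_bound \<equiv> ((2 * of_int n + 1) * (2 * of_int n + 3) - 9)\<^sup>2"

text \<open>The four absolute values can be grouped into two pairs in three ways. Each time the pair
  sums are W yz + u and W yz - u, and \<open>G\<close> is the corresponding u^2.\<close>

lemma quad_norm_le_pairs:
  assumes "sig_pos (i, j, m, k)"
  defines "W \<equiv> real_of_int (m + k)"
  assumes G: "G = (2 * of_int i + (2 * of_int n - 1) * of_int j)\<^sup>2 \<or>
    G = (2 * of_int n - 1) * (2 * of_int n + 1) * (of_int m - of_int k)\<^sup>2 \<or>
    G = (2 * of_int n - 1) * (2 * of_int n + 3) * (of_int j)\<^sup>2"
  shows "0 < W\<^sup>2 * ((2 * of_int n + 1) * (2 * of_int n + 3)) - G"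
    and "quad_norm x y z (i, j, m, k) \<le> ((W\<^sup>2 * ((2 * of_int n + 1) * (2 * of_int n + 3)) - G) / 4)\<^sup>2"
proof -
  define A B C D where "A = conj_val x y z (i, j, m, k)" and "B = conj_val (- x) y z (i, j, m, k)"
    and "C = - conj_val x (- y) z (i, j, m, k)" and "D = - conj_val x y (- z) (i, j, m, k)"
  have pos: "0 < A" "0 < B" "0 < C" "0 < D"
    using assms(1) by (simp_all add: sig_pos_def A_def B_def C_def D_def)
  have N: "quad_norm x y z (i, j, m, k) = A * B * C * D"
    by (simp add: quad_norm_def A_def B_def C_def D_def)
  have sums: "A + B = W * (y * z) + (2 * of_int i + of_int j * (x * x))"
    "C + D = W * (y * z) - (2 * of_int i + of_int j * (x * x))"
    "A + C = W * (y * z) + (of_int m - of_int k) * (x * y)"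
    "B + D = W * (y * z) - (of_int m - of_int k) * (x * y)"
    "A + D = W * (y * z) + of_int j * (x * z)" "B + C = W * (y * z) - of_int j * (x * z)"
    unfolding A_def B_def C_def D_def W_def conj_val_def by (simp_all add: algebra_simps) (simp_all add: field_simps)
  have prod: "(W * (y * z) + u) * (W * (y * z) - u) = W\<^sup>2 * ((y * y) * (z * z)) - u\<^sup>2" for u
    by (simp add: power2_eq_square algebra_simps)
  have E1: "(A + B) * (C + D) = W\<^sup>2 * ((y * y) * (z * z)) - (2 * of_int i + of_int j * (x * x))\<^sup>2"
    unfolding sums prod ..
  have E2: "(A + C) * (B + D) = W\<^sup>2 * ((y * y) * (z * z)) - (x * x) * (y * y) * (of_int m - of_int k)\<^sup>2"
    unfolding sums prod by (simp add: power_mult_distrib power2_eq_square mult_ac)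
  have E3: "(A + D) * (B + C) = W\<^sup>2 * ((y * y) * (z * z)) - (x * x) * (z * z) * (of_int j)\<^sup>2"
    unfolding sums prod by (simp add: power_mult_distrib power2_eq_square mult_ac)
  have P1: "0 < (A + B) * (C + D)" "A * B * C * D \<le> ((A + B) * (C + D) / 4)\<^sup>2"
    using pos prod_le_square_halfsums[OF pos] by simp_all
  have P2: "0 < (A + C) * (B + D)" "A * B * C * D \<le> ((A + C) * (B + D) / 4)\<^sup>2"
    using pos prod_le_square_halfsums[OF pos(1,3,2,4)] by (simp, simp only: mult_ac)
  have P3: "0 < (A + D) * (B + C)" "A * B * C * D \<le> ((A + D) * (B + C) / 4)\<^sup>2"
    using pos prod_le_square_halfsums[OF pos(1,4,2,3)] by (simp, simp only: mult_ac)
  show "0 < W\<^sup>2 * ((2 * of_int n + 1) * (2 * of_int n + 3)) - G"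
    using G P1(1) P2(1) P3(1) unfolding E1 E2 E3 squares by (auto simp: mult.commute)
  show "quad_norm x y z (i, j, m, k) \<le> ((W\<^sup>2 * ((2 * of_int n + 1) * (2 * of_int n + 3)) - G) / 4)\<^sup>2"
    using G P1(2) P2(2) P3(2) unfolding N E1 E2 E3 squares by (auto simp: mult.commute)
qed

text \<open>A norm above (r - 9)^2 forces G < 36 for all three groupings. Two of them carry a factor
  of at least 36 and give m = k and j = 0; the third leaves (2i)^2 < 36, that is, yz + i with |i| at
  most 2.\<close>

lemma height_2_norm_le:
  assumes indec: "sig_indec (i, j, m, k)" and ht: "m + k = 2"
  shows "quad_norm x y z (i, j, m, k) \<le> norm_bound"
proof (rule ccontr)
  assume "\<not> quad_norm x y z (i, j, m, k) \<le> norm_bound"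
  then have large: "norm_bound < quad_norm x y z (i, j, m, k)" by simp
  have sig: "sig_pos (i, j, m, k)" using indec by (simp add: sig_indec_def)
  define r where "r = (2 * real_of_int n + 1) * (2 * real_of_int n + 3)"
  have G_less: "G < 36" if "0 < 4 * r - G" "quad_norm x y z (i, j, m, k) \<le> ((4 * r - G) / 4)\<^sup>2" for G
  proof (rule ccontr)
    assume "\<not> G < 36"
    then have "((4 * r - G) / 4)\<^sup>2 \<le> (r - 9)\<^sup>2" using that(1) by (intro power_mono) auto
    then show False using large that(2) by (simp add: r_def)
  qed
  have W: "(real_of_int (m + k))\<^sup>2 * ((2 * of_int n + 1) * (2 * of_int n + 3)) = 4 * r"
    using ht by (simp add: r_def)
  have X: "(2 * of_int i + (2 * of_int n - 1) * of_int j)\<^sup>2 < (36::real)"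
    and Y: "(2 * of_int n - 1) * (2 * of_int n + 1) * (of_int m - of_int k)\<^sup>2 < (36::real)"
    and Z: "(2 * of_int n - 1) * (2 * of_int n + 3) * (of_int j)\<^sup>2 < (36::real)"
    by (rule G_less; insert quad_norm_le_pairs[OF sig] W; simp)+
  have sq: "t = 0" if "real_of_int c * (of_int t)\<^sup>2 < 36" "36 \<le> c" for c t :: int
  proof (rule ccontr)
    assume "t \<noteq> 0"
    then have "1 \<le> t\<^sup>2" by (simp add: int_one_le_iff_zero_less)
    then have "c \<le> c * t\<^sup>2" using that(2) by simp
    then have "36 \<le> c * t\<^sup>2" using that(2) by linarith
    then have "real_of_int 36 \<le> real_of_int (c * t\<^sup>2)" by (simp only: of_int_le_iff)
    then show False using that(1) by simp
  qed
  have big: "36 \<le> (2*n-1) * (2*n+1)" "36 \<le> (2*n-1) * (2*n+3)"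
    using mult_mono[of 6 "2*n-1" 6 "2*n+1"] mult_mono[of 6 "2*n-1" 6 "2*n+3"] n_ge by simp_all
  have "m - k = 0" using sq[OF _ big(1), of "m - k"] Y by simp
  then have mk: "m = 1" "k = 1" using ht by simp_all
  have j: "j = 0" using sq[OF _ big(2), of j] Z by simp
  have "(2 * real_of_int i)\<^sup>2 < 6\<^sup>2" using X j by simp
  then have "\<bar>2 * real_of_int i\<bar> < 6" using abs_le_square_iff[of 6 "2 * real_of_int i"] by simp
  then have i: "\<bar>i\<bar> \<le> 2" by linarith
  \<comment> \<open>In both hexagons the points with j = 0 have first coordinate at most 1 in
    absolute value, so i is shared between the two summands.\<close>
  define s where "s = (if 0 < i then 1 else if i < 0 then -1 else (0::int))"
  have s: "\<bar>s\<bar> \<le> 1" "\<bar>i - s\<bar> \<le> 1" using i by (auto simp: s_def)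
  have "sig_pos (s, 0, 1, 0)" "sig_pos (i - s, 0, 0, 1)"
    by (rule in_cone_sig_pos; use s n_ge in simp)+
  moreover have "(i, j, m, k) = (s, 0, 1, 0) + (i - s, 0, 0, 1)"
    by (simp add: mk j)
  ultimately show False using indec unfolding sig_indec_def by blast
qed

section \<open>Decomposition and the minimal counterexample\<close>

lemma sig_indec_transfer:
  assumes "sig_indec w" and "\<And>w. sig_pos (f w) \<longleftrightarrow> sig_pos w" and "\<And>w. sig_pos (g w) \<longleftrightarrow> sig_pos w"
    and "\<And>w. g (f w) = w" and "\<And>u v. g (u + v) = g u + g v"
  shows "sig_indec (f w)"
  using assms unfolding sig_indec_def by metis

lemma sig_indec_maps:
  assumes "sig_indec w"
  shows "sig_indec (mul_p n w)" "sig_indec (div_q n w)" "sig_indec (div_r n w)"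
    "sig_indec (flip_x n w)" "sig_indec (neg_flip_y w)"
  using sig_indec_transfer[where f = "mul_p n" and g = "div_p n", OF assms sig_pos_maps(1,2) quad_maps_inverse(1) quad_maps_add(2)]
    sig_indec_transfer[where f = "div_q n" and g = "mul_q n", OF assms sig_pos_maps(4,3) quad_maps_inverse(3) quad_maps_add(3)]
    sig_indec_transfer[where f = "div_r n" and g = "mul_r n", OF assms sig_pos_maps(6,5) quad_maps_inverse(4) quad_maps_add(5)]
    sig_indec_transfer[where f = "flip_x n" and g = "flip_x n", OF assms sig_pos_maps(7,7) quad_maps_inverse(5) quad_maps_add(7)]
    sig_indec_transfer[where f = "neg_flip_y" and g = "neg_flip_y", OF assms sig_pos_maps(8,8) quad_maps_inverse(6) quad_maps_add(8)] .

lemma not_indec_in_cone: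
  assumes ht: "3 \<le> m + k" and m: "2 \<le> m" and D: "0 \<le> i + 2*n*j"
    and cone: "in_cone (2*n) (i, j, m, k)" and j: "\<bar>j\<bar> \<le> m + k"
  shows "\<not> sig_indec (i, j, m, k)"
proof -
  have "1 \<le> 2*n" using n_ge by simp
  then obtain s t where st: "(s, t) \<in> {(1, 1), (0, 1), (1, 0)}" and rest: "in_cone (2*n) (i - s, j - t, m - 1, k)"
    using in_cone_descent[OF _ m cone j D] by blast
  have "sig_pos (i - s, j - t, m - 1, k)"
    by (rule in_cone_sig_pos[OF rest]) (use ht in simp)
  moreover have "sig_pos (s, t, 1, 0)"
    by (rule in_cone_sig_pos) (use st n_ge in auto)
  moreover have "(i, j, m, k) = (s, t, 1, 0) + (i - s, j - t, m - 1, k)"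
    by simp
  ultimately show ?thesis unfolding sig_indec_def by blast
qed

text \<open>Subtracting a vertex lowers its own coordinate among A, B, C, D by 2n - 1 and keeps the
  others, so one coordinate of at least 2n - 1 suffices. Counting alone would give this from height
  4 on; divisibility of the pair sums brings it down to 3.\<close>

lemma not_indec_in_tetra:
  assumes "0 \<le> i - m - k" "0 \<le> (2*n-1)*j - 2*n*i + 2*n*m + (4*n\<^sup>2+2*n-1)*k"
    "0 \<le> 2*n*m + k - i - (2*n-1)*j" "0 \<le> i - m - 2*n*k" and T: "3 \<le> tetra_height n (i, j, m, k)"
  shows "\<not> sig_indec (i, j, m, k)"
proof -
  define a A B C D where "a = 2*n-1" and "A = i - m - k"
    and "B = (2*n-1)*j - 2*n*i + 2*n*m + (4*n\<^sup>2+2*n-1)*k"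
    and "C = 2*n*m + k - i - (2*n-1)*j" and "D = i - m - 2*n*k"
  have split: ?thesis if "sig_pos (i', j', m', k')" "sig_pos (i - i', j - j', m - m', k - k')" for i' j' m' k'
  proof -
    have "(i, j, m, k) = (i', j', m', k') + (i - i', j - j', m - m', k - k')" by simp
    then show ?thesis using that unfolding sig_indec_def by blast
  qed
  \<comment> \<open>The pair sums are multiples of \<open>a\<close>; were all four below \<open>a\<close>, each would be at most \<open>a\<close>,
      whereas the total is \<open>a\<close> times the height.\<close>
  have "a \<le> A \<or> a \<le> B \<or> a \<le> C \<or> a \<le> D"
  proof (rule ccontr)
    assume "\<not> ?thesis"
    moreover have "B + D = a * (j - i + m + (2*n+1)*k)" "A + C = a * (m - j)"
      by (simp_all add: a_def A_def B_def C_def D_def algebra_simps power2_eq_square)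
    ultimately have "a * (j - i + m + (2*n+1)*k) < a * 2" "a * (m - j) < a * 2"
      by linarith+
    moreover have "0 < a" using n_ge by (simp add: a_def)
    ultimately have "j - i + m + (2*n+1)*k < 2" "m - j < 2" by simp_all
    then show False using T by simp
  qed
  moreover have v: "sig_pos (2*n, -1, 0, 1)" "sig_pos (1, 1, 1, 0)" "sig_pos (1, 0, 1, 0)"
    by (rule in_cone_sig_pos; use n_ge in simp)+
  moreover have "sig_pos (2*n, 2*n+1, 2*n+1, -1)"
    using v(2) sig_pos_maps(3)[of "(1, 1, 1, 0)"] by (simp add: add.commute)
  moreover have "sig_pos (i - 2*n, j - -1, m - 0, k - 1)" if "a \<le> A"
    by (rule tetra_sig_pos; insert that assms; simp add: a_def A_def algebra_simps power2_eq_square)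
  moreover have "sig_pos (i - 1, j - 1, m - 1, k - 0)" if "a \<le> B"
    by (rule tetra_sig_pos; insert that assms; simp add: a_def B_def algebra_simps power2_eq_square)
  moreover have "sig_pos (i - 1, j - 0, m - 1, k - 0)" if "a \<le> C"
    by (rule tetra_sig_pos; insert that assms; simp add: a_def C_def algebra_simps power2_eq_square)
  moreover have "sig_pos (i - 2*n, j - (2*n+1), m - (2*n+1), k - -1)" if "a \<le> D"
    by (rule tetra_sig_pos; insert that assms; simp add: a_def D_def algebra_simps power2_eq_square)
  ultimately show ?thesis using split by blast
qed

theorem sig_indec_norm_le:
  assumes "sig_indec w"
  shows "quad_norm x y z w \<le> norm_bound"
proof (rule ccontr)
  define bad where "bad v \<longleftrightarrow> sig_indec v \<and> norm_bound < quad_norm x y z v" for v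
  assume "\<not> quad_norm x y z w \<le> norm_bound"
  then have "bad w" using assms by (simp add: bad_def)
  have bad_maps: "bad (mul_p n v)" "bad (div_q n v)" "bad (div_r n v)" "bad (flip_x n v)" "bad (neg_flip_y v)"
    if "bad v" for v
    using that sig_indec_maps by (simp_all add: bad_def quad_norm_maps)
  have heights_pos: "0 < height v" "0 < tetra_height n v" if "bad v" for v
    using that height_pos tetra_height_bounds(1) by (simp_all add: bad_def sig_indec_def)
  obtain v where v: "bad v"
    and *: "\<forall>u. bad u \<longrightarrow> nat (min (height v) (tetra_height n v)) \<le> nat (min (height u) (tetra_height n u))"
    using ex_has_least_nat[of bad w "\<lambda>u. nat (min (height u) (tetra_height n u))"] \<open>bad w\<close> by blast
  have least: "min (height v) (tetra_height n v) \<le> min (height u) (tetra_height n u)" if "bad u" for u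
  proof -
    have "0 < min (height v) (tetra_height n v)" using heights_pos[OF v] by simp
    then show ?thesis using * that nat_le_eq_zle by blast
  qed
  then have min: "min (height v) (tetra_height n v) \<le> height u" "min (height v) (tetra_height n v) \<le> tetra_height n u"
    if "bad u" for u
    using that by (meson min.boundedE)+
  define r where "r = (2 * real_of_int n + 1) * (2 * of_int n + 3)"
  have r: "18 \<le> r"
    using mult_mono[of 6 "2 * real_of_int n + 1" 6 "2 * real_of_int n + 3"] n_ge by (simp add: r_def)
  \<comment> \<open>r^2/4 is the mean bound at tetrahedral height 2, the largest that survives
    there; it also covers height 1.\<close>
  have "r / 2 \<le> r - 9" "0 \<le> r / 2" using r by simp_all
  then have "(r / 2)\<^sup>2 \<le> (r - 9)\<^sup>2" by (rule power_mono)
  then have r2: "r\<^sup>2 / 4 \<le> norm_bound" by (simp add: r_def power_divide)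
  show False
  proof (cases "height v \<le> tetra_height n v")
    case True
    have mv: "height v \<le> height u" "height v \<le> tetra_height n u" if "bad u" for u
      using min[OF that] True by simp_all
    \<comment> \<open>One inequality per neighbouring facet: \<open>div_q\<close> bounds k,
      \<open>mul_p\<close> bounds -j, their composite bounds i - j, and the tetrahedron bounds
      i.\<close>
    have ineqs: "0 \<le> k \<and> - j \<le> m + k \<and> i - j \<le> m + (2*n+1)*k \<and> i \<le> m + 2*n*k"
      if "bad (i, j, m, k)" "m + k = height v" for i j m k
    proof -
      have "height v \<le> height (div_q n (i, j, m, k))" "height v \<le> height (mul_p n (i, j, m, k))"
        "height v \<le> height (div_q n (mul_p n (i, j, m, k)))" "height v \<le> tetra_height n (i, j, m, k)"
        by (intro mv bad_maps that(1))+
      then have "0 \<le> (2*n-1) * k" "0 \<le> (2*n-1) * (m + k + j)" "0 \<le> (2*n-1) * (m + (2*n+1)*k - (i - j))"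
        "i \<le> m + 2*n*k"
        unfolding that(2)[symmetric] by (simp_all add: algebra_simps)
      moreover have "0 < 2*n-1" using n_ge by simp
      ultimately show ?thesis by (simp add: zero_le_mult_iff)
    qed
    obtain i j m k where vt: "v = (i, j, m, k)" by (cases v)
    \<comment> \<open>All four have the height of \<open>v\<close>, so \<open>ineqs\<close> applies
      to each; together they give every inequality of the cone.\<close>
    have sym: "bad (i, j, m, k)" "bad (- i, - j, m, k)" "bad (i + (2*n-1)*j, - j, k, m)" "bad (- (i + (2*n-1)*j), j, k, m)"
      using v bad_maps(4,5)[of v] bad_maps(5)[of "flip_x n v"] by (simp_all add: vt)
    have cone: "in_cone (2*n) (i, j, m, k)" "\<bar>j\<bar> \<le> m + k"
      using sym[THEN ineqs] by (simp_all add: vt algebra_simps abs_le_iff)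
    have ht: "0 < m + k" using heights_pos(1)[OF v] by (simp add: vt)
    consider "m + k = 1" | "m + k = 2" | "3 \<le> m + k" using ht by linarith
    then show False
    proof cases
      case 1
      then have "quad_norm x y z v \<le> r\<^sup>2 / 16"
        using quad_norm_le_height[of v] v by (simp add: vt bad_def sig_indec_def r_def power_divide)
      also have "\<dots> \<le> r\<^sup>2 / 4" by simp
      finally show False using r2 v by (simp add: bad_def)
    next
      case 2
      then show False using height_2_norm_le[of i j m k] v by (simp add: vt bad_def)
    next
      case 3
      \<comment> \<open>One of m, k is at least 2. \<open>neg_flip_y\<close> settles the sign of i +
        2nj here, and \<open>flip_x\<close> exchanges m and k afterwards.\<close>
      have not_indec: "\<not> sig_indec (i, j, m, k)"
        if "in_cone (2*n) (i, j, m, k)" "\<bar>j\<bar> \<le> m + k" "3 \<le> m + k" "2 \<le> m" for i j m k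
      proof (cases "0 \<le> i + 2*n*j")
        case True
        then show ?thesis using not_indec_in_cone that by blast
      next
        case False
        moreover have "in_cone (2*n) (- i, - j, m, k)" using that(1) by (simp add: abs_le_iff)
        ultimately have "\<not> sig_indec (neg_flip_y (i, j, m, k))"
          using not_indec_in_cone[of m k "- i" "- j"] that by simp
        then show ?thesis using sig_indec_maps(5) by blast
      qed
      show False
      proof (cases "2 \<le> m")
        case True
        then show False using not_indec[OF cone 3] v by (simp add: vt bad_def)
      next
        case False
        then have "2 \<le> k" using 3 by linarith
        moreover have "in_cone (2*n) (i + (2*n-1)*j, - j, k, m)"
          using cone(1) by (simp add: algebra_simps)
        ultimately have "\<not> sig_indec (i + (2*n-1)*j, - j, k, m)"
          using cone(2) 3 by (intro not_indec) simp_all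
        then show False using sym(3) by (simp add: bad_def)
      qed
    qed
  next
    case False
    have mv: "tetra_height n v \<le> height u" if "bad u" for u
      using min[OF that] False by simp
    obtain i j m k where vt: "v = (i, j, m, k)" by (cases v)
    \<comment> \<open>Across each face of the tetrahedron lies a facet of the first type, and
      comparing values there says that one barycentric coordinate is nonnegative.\<close>
    have "tetra_height n v \<le> height v" "tetra_height n v \<le> height (div_q n v)"
      "tetra_height n v \<le> height (div_r n v)" "tetra_height n v \<le> height (div_q n (div_r n v))"
      by (intro mv bad_maps v)+
    then have ineqs: "0 \<le> i - m - k" "0 \<le> (2*n-1)*j - 2*n*i + 2*n*m + (4*n\<^sup>2+2*n-1)*k"
      "0 \<le> 2*n*m + k - i - (2*n-1)*j" "0 \<le> i - m - 2*n*k"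
      by (simp_all add: vt algebra_simps power2_eq_square)
    have "tetra_height n v \<le> 2"
      using not_indec_in_tetra[OF ineqs] v by (force simp: vt bad_def)
    then have "real_of_int (tetra_height n v) ^ 4 \<le> 2 ^ 4"
      using heights_pos(2)[OF v] by (intro power_mono) simp_all
    then have "real_of_int (tetra_height n v) ^ 4 * r\<^sup>2 / 64 \<le> 2 ^ 4 * r\<^sup>2 / 64"
      by (intro divide_right_mono mult_right_mono) simp_all
    then have "quad_norm x y z v \<le> r\<^sup>2 / 4"
      using tetra_height_bounds(2)[of v] v by (simp add: bad_def sig_indec_def r_def)
    then show False using r2 v by (simp add: bad_def)
  qed
qed

end

section \<open>The biquadratic field and its embeddings\<close>

lemma irrational_if_between_squares:
  fixes t :: real
  assumes "t * t = of_int N" "m\<^sup>2 < N" "N < (m + 1)\<^sup>2" "0 \<le> m"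
  shows "t \<notin> \<rat>"
proof
  assume "t \<in> \<rat>"
  have "poly [:- of_int N, 0, 1:] t = 0" using assms(1) by simp
  then have "algebraic_int t"
    by (rule algebraic_int.intros[rotated 2]) (auto simp: coeff_pCons split: nat.splits)
  then obtain k where "t = of_int k"
    using rational_algebraic_int_is_int[OF _ \<open>t \<in> \<rat>\<close>] by (auto elim: Ints_cases)
  then have "real_of_int (k * k) = of_int N" using assms(1) by simp
  then have "k * k = N" by (simp only: of_int_eq_iff)
  then have "\<bar>k\<bar>\<^sup>2 = N" by (simp add: power2_eq_square)
  then have "m < \<bar>k\<bar>" "\<bar>k\<bar> < m + 1"
    using power2_less_imp_less[of m "\<bar>k\<bar>"] power2_less_imp_less[of "\<bar>k\<bar>" "m + 1"] assms(2-4) by simp_all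
  then show False by simp
qed

text \<open>The roots are parameters, so a conjugate keeps the coefficients and changes signs of
  roots.\<close>

definition rat_comb :: "real \<Rightarrow> real \<Rightarrow> real \<Rightarrow> real \<Rightarrow> real \<Rightarrow> real \<Rightarrow> real \<Rightarrow> real" where
  "rat_comb x y z A B C D = A + B * (x * y) + C * (x * z) + D * (y * z)"

lemma rat_comb_add:
  "rat_comb x y z A B C D + rat_comb x y z A' B' C' D' = rat_comb x y z (A + A') (B + B') (C + C') (D + D')"
  by (simp add: rat_comb_def algebra_simps)

lemma rat_comb_mult:
  assumes "x * x = a" "y * y = b" "z * z = c"
  shows "rat_comb x y z A B C D * rat_comb x y z A' B' C' D' =
    rat_comb x y z (A * A' + a * b * B * B' + a * c * C * C' + b * c * D * D')
      (A * B' + B * A' + c * (C * D' + D * C')) (A * C' + C * A' + b * (B * D' + D * B'))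
      (A * D' + D * A' + a * (B * C' + C * B'))"
  unfolding assms[symmetric] rat_comb_def by (simp add: algebra_simps)

text \<open>These are the relative norms to the three quadratic subfields.\<close>

lemma rat_comb_mult_conj:
  "rat_comb x y z A B C D * rat_comb x y z A (- B) (- C) D =
     (A * A + (y*y) * (z*z) * (D * D) - (x*x) * (y*y) * (B * B) - (x*x) * (z*z) * (C * C)) +
     2 * (A * D - (x*x) * (B * C)) * (y * z)"
  "rat_comb x y z A B C D * rat_comb x y z A B (- C) (- D) =
     (A * A + (x*x) * (y*y) * (B * B) - (y*y) * (z*z) * (D * D) - (x*x) * (z*z) * (C * C)) +
     2 * (A * B - (z*z) * (C * D)) * (x * y)"
  "rat_comb x y z A B C D * rat_comb x y z A (- B) C (- D) =
     (A * A + (x*x) * (z*z) * (C * C) - (y*y) * (z*z) * (D * D) - (x*x) * (y*y) * (B * B)) +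
     2 * (A * C - (y*y) * (B * D)) * (x * z)"
  by (simp_all add: rat_comb_def algebra_simps)

context consecutive_roots
begin

lemma irrational: "x * y \<notin> \<rat>" "x * z \<notin> \<rat>" "y * z \<notin> \<rat>"
proof -
  have sq: "(x * y) * (x * y) = of_int (4*n\<^sup>2 - 1)" "(x * z) * (x * z) = of_int (4*n\<^sup>2 + 4*n - 3)"
    "(y * z) * (y * z) = of_int (4*n\<^sup>2 + 8*n + 3)"
    using squares by (simp_all add: square_rules[OF squares] algebra_simps power2_eq_square)
  show "x * y \<notin> \<rat>"
    by (rule irrational_if_between_squares[OF sq(1), of "2*n-1"]) (use n_ge in \<open>auto simp: power2_eq_square algebra_simps\<close>)
  show "x * z \<notin> \<rat>"
    by (rule irrational_if_between_squares[OF sq(2), of "2*n"]) (use n_ge in \<open>auto simp: power2_eq_square algebra_simps\<close>)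
  show "y * z \<notin> \<rat>"
    by (rule irrational_if_between_squares[OF sq(3), of "2*n+1"]) (use n_ge in \<open>auto simp: power2_eq_square algebra_simps\<close>)
qed

lemma root_comb_eq_0:
  assumes "t \<notin> \<rat>" "A \<in> \<rat>" "B \<in> \<rat>" "A + B * t = 0"
  shows "A = 0" "B = 0"
proof -
  show "B = 0"
  proof (rule ccontr)
    assume "B \<noteq> 0"
    then have "t = - A / B" using assms(4) by (simp add: field_simps eq_neg_iff_add_eq_0)
    then show False using assms(1-3) by simp
  qed
  then show "A = 0" using assms(4) by simp
qed

lemma of_int_root_facts:
  "x * x \<in> \<rat>" "y * y \<in> \<rat>" "z * z \<in> \<rat>" "x * x \<noteq> 0" "y * y \<noteq> 0" "z * z \<noteq> 0"
  using pos by (simp_all, simp_all add: squares)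

text \<open>The relative norms vanish as well, and their irrational parts give AD = x^2 BC, AB = z^2
  CD and AC = y^2 BD. If B or C is 0, at most one coefficient can be nonzero. Otherwise the last two
  relations give A = Dyz or A = -Dyz, so A = 0 by irrationality, against the first relation.\<close>

lemma rat_comb_eq_0:
  assumes "A \<in> \<rat>" "B \<in> \<rat>" "C \<in> \<rat>" "D \<in> \<rat>" and zero: "rat_comb x y z A B C D = 0"
  shows "A = 0 \<and> B = 0 \<and> C = 0 \<and> D = 0"
proof -
  note Q = assms(1-4) of_int_root_facts(1-3)
  have s: "A + B * (x * y) + C * (x * z) + D * (y * z) = 0"
    using zero by (simp add: rat_comb_def)
  note conj = rat_comb_mult_conj[of x y z A B C D, unfolded zero mult_zero_left, symmetric]
  have AD: "A * D = (x*x) * (B * C)" and AB: "A * B = (z*z) * (C * D)" and AC: "A * C = (y*y) * (B * D)"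
    using root_comb_eq_0(2)[OF irrational(3) _ _ conj(1)] root_comb_eq_0(2)[OF irrational(1) _ _ conj(2)]
      root_comb_eq_0(2)[OF irrational(2) _ _ conj(3)] Q by simp_all
  have nz: "x * y \<noteq> 0" "x * z \<noteq> 0" "y * z \<noteq> 0" using pos by simp_all
  consider "B = 0" | "C = 0" | "B \<noteq> 0" "C \<noteq> 0" by blast
  then show ?thesis
  proof cases
    case 1
    then show ?thesis using AD AB AC s nz of_int_root_facts(4-6) by auto
  next
    case 2
    then show ?thesis using AD AB AC s nz of_int_root_facts(4-6) by auto
  next
    case 3
    have "(A * B) * (A * C) = ((z*z) * (C * D)) * ((y*y) * (B * D))" by (simp only: AB AC)
    then have "(A * A - (y*z) * D * ((y*z) * D)) * (B * C) = 0" by (simp add: algebra_simps)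
    then have "(A + D * (y*z)) * (A + (- D) * (y * z)) = 0" using 3 by (simp add: algebra_simps)
    then have "A + D * (y*z) = 0 \<or> A + (- D) * (y * z) = 0" by simp
    then have "A = 0" using root_comb_eq_0(1)[OF irrational(3)] Q by (metis Rats_minus_iff)
    then show ?thesis using AD 3 of_int_root_facts(4) by simp
  qed
qed

lemma rat_comb_eq_iff:
  assumes "A \<in> \<rat>" "B \<in> \<rat>" "C \<in> \<rat>" "D \<in> \<rat>" "A' \<in> \<rat>" "B' \<in> \<rat>" "C' \<in> \<rat>" "D' \<in> \<rat>"
  shows "rat_comb x y z A B C D = rat_comb x y z A' B' C' D' \<longleftrightarrow> A = A' \<and> B = B' \<and> C = C' \<and> D = D'"
proof
  assume "rat_comb x y z A B C D = rat_comb x y z A' B' C' D'"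
  then have "rat_comb x y z (A - A') (B - B') (C - C') (D - D') = 0"
    by (simp add: rat_comb_def algebra_simps)
  from rat_comb_eq_0[OF _ _ _ _ this] show "A = A' \<and> B = B' \<and> C = C' \<and> D = D'"
    using assms by simp
qed simp

definition biquad_field :: "real set" where
  "biquad_field = {rat_comb x y z A B C D | A B C D. A \<in> \<rat> \<and> B \<in> \<rat> \<and> C \<in> \<rat> \<and> D \<in> \<rat>}"

lemma biquad_fieldI:
  "A \<in> \<rat> \<Longrightarrow> B \<in> \<rat> \<Longrightarrow> C \<in> \<rat> \<Longrightarrow> D \<in> \<rat> \<Longrightarrow> rat_comb x y z A B C D \<in> biquad_field"
  by (auto simp: biquad_field_def)

lemma biquad_fieldE:
  assumes "h \<in> biquad_field"
  obtains A B C D where "A \<in> \<rat>" "B \<in> \<rat>" "C \<in> \<rat>" "D \<in> \<rat>" "h = rat_comb x y z A B C D"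
  using assms by (auto simp: biquad_field_def)

lemma biquad_field_base:
  "A \<in> \<rat> \<Longrightarrow> A \<in> biquad_field" "x * y \<in> biquad_field" "x * z \<in> biquad_field" "y * z \<in> biquad_field"
  using biquad_fieldI[of A 0 0 0] biquad_fieldI[of 0 1 0 0] biquad_fieldI[of 0 0 1 0] biquad_fieldI[of 0 0 0 1]
  by (simp_all add: rat_comb_def)

lemma biquad_field_closed:
  assumes "g \<in> biquad_field" "h \<in> biquad_field"
  shows "g + h \<in> biquad_field" "g * h \<in> biquad_field"
proof -
  obtain A B C D where g: "A \<in> \<rat>" "B \<in> \<rat>" "C \<in> \<rat>" "D \<in> \<rat>" "g = rat_comb x y z A B C D"
    using assms(1) by (rule biquad_fieldE)
  obtain A' B' C' D' where h: "A' \<in> \<rat>" "B' \<in> \<rat>" "C' \<in> \<rat>" "D' \<in> \<rat>" "h = rat_comb x y z A' B' C' D'"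
    using assms(2) by (rule biquad_fieldE)
  show "g + h \<in> biquad_field" "g * h \<in> biquad_field"
    unfolding g h rat_comb_add rat_comb_mult[OF refl refl refl]
    using g h of_int_root_facts by (auto intro!: biquad_fieldI)
qed

text \<open>Two successive relative norms, to Q(yz) and then to Q, turn \<open>h\<close> into a
  nonzero rational.\<close>

lemma biquad_field_inverse:
  assumes "h \<in> biquad_field" "h \<noteq> 0"
  shows "inverse h \<in> biquad_field"
proof -
  obtain A B C D where h: "A \<in> \<rat>" "B \<in> \<rat>" "C \<in> \<rat>" "D \<in> \<rat>" "h = rat_comb x y z A B C D"
    using assms(1) by (rule biquad_fieldE)
  define g where "g = rat_comb x y z A (- B) (- C) D"
  define u v where "u = A * A + (y*y) * (z*z) * (D * D) - (x*x) * (y*y) * (B * B) - (x*x) * (z*z) * (C * C)"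
    and "v = 2 * (A * D - (x*x) * (B * C))"
  have g: "g \<in> biquad_field" using h by (simp add: g_def biquad_fieldI)
  have uv: "u \<in> \<rat>" "v \<in> \<rat>" using h of_int_root_facts by (simp_all add: u_def v_def)
  have gh: "h * g = u + v * (y * z)"
    unfolding h g_def u_def v_def by (rule rat_comb_mult_conj)
  have "g \<noteq> 0"
    using rat_comb_eq_0[of A "- B" "- C" D] h assms(2) by (auto simp: g_def rat_comb_def)
  then have uv0: "u + v * (y * z) \<noteq> 0" using gh assms(2) by (metis mult_eq_0_iff)
  have "u + - v * (y * z) \<noteq> 0"
    using root_comb_eq_0[OF irrational(3), of u "- v"] uv uv0 by auto
  moreover have N: "(u + v * (y * z)) * (u + - v * (y * z)) = u * u - (y*y) * (z*z) * (v * v)"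
    by (simp add: algebra_simps)
  ultimately have N0: "u * u - (y*y) * (z*z) * (v * v) \<noteq> 0"
    using uv0 by (metis mult_eq_0_iff)
  have "h * (g * (u + - v * (y * z))) = u * u - (y*y) * (z*z) * (v * v)"
    using N unfolding gh[symmetric] by (simp only: mult.assoc)
  then have "inverse h = (g * (u + - v * (y * z))) * inverse (u * u - (y*y) * (z*z) * (v * v))"
    using N0 assms(2) by (simp add: field_simps)
  also have "\<dots> \<in> biquad_field"
    using uv of_int_root_facts by (intro biquad_field_closed biquad_field_base g) simp_all
  finally show ?thesis .
qed

end

section \<open>The generated field and its four embeddings\<close>

lemma type_algebra_inverses:
  fixes h :: "'a::field"
  shows "\<ominus>\<^bsub>ring_of_type_algebra\<^esub> h = - h"
    and "h \<noteq> 0 \<Longrightarrow> inv\<^bsub>ring_of_type_algebra\<^esub> h = inverse h"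
  unfolding a_inv_def m_inv_def
  by (rule the_equality; auto simp: ring_of_type_algebra_def add_eq_0_iff2 field_simps)+

lemma rat_adjoin_closed:
  shows "1 \<in> rat_adjoin S" "h \<in> S \<Longrightarrow> h \<in> rat_adjoin S"
    "g \<in> rat_adjoin S \<Longrightarrow> h \<in> rat_adjoin S \<Longrightarrow> g + h \<in> rat_adjoin S"
    "g \<in> rat_adjoin S \<Longrightarrow> h \<in> rat_adjoin S \<Longrightarrow> g * h \<in> rat_adjoin S"
    "h \<in> rat_adjoin S \<Longrightarrow> - h \<in> rat_adjoin S"
    "h \<in> rat_adjoin S \<Longrightarrow> h \<noteq> 0 \<Longrightarrow> inverse h \<in> rat_adjoin S"
  using generate_field.one[of ring_of_type_algebra S] generate_field.incl[of h S ring_of_type_algebra]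
    generate_field.eng_add[of g ring_of_type_algebra S h] generate_field.eng_mult[of g ring_of_type_algebra S h]
    generate_field.a_inv[of h ring_of_type_algebra S] generate_field.m_inv[of h ring_of_type_algebra S]
  by (simp_all add: rat_adjoin_def type_algebra_inverses, simp_all add: ring_of_type_algebra_def)

lemma rat_adjoin_Rats:
  assumes "h \<in> \<rat>"
  shows "h \<in> rat_adjoin S"
proof -
  have nat: "of_nat (Suc k) \<in> rat_adjoin S" for k
  proof (induction k)
    case (Suc k)
    show ?case using rat_adjoin_closed(3)[OF Suc rat_adjoin_closed(1)] by (simp add: add_ac)
  qed (simp add: rat_adjoin_closed(1))
  have zero: "0 \<in> rat_adjoin S"
    using rat_adjoin_closed(3)[OF rat_adjoin_closed(1) rat_adjoin_closed(5)[OF rat_adjoin_closed(1)], of S] by simp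
  have int: "of_int k \<in> rat_adjoin S" for k
  proof (cases k)
    case (nonneg m)
    then show ?thesis using nat zero by (cases m) simp_all
  next
    case (neg m)
    then show ?thesis using rat_adjoin_closed(5)[OF nat] by simp
  qed
  obtain k m where "m > 0" "h = of_int k / of_int m"
    using assms by (auto elim: Rats_cases')
  then have "h = of_int k * inverse (of_int m)" "of_int m \<noteq> (0::real)" by (simp_all add: divide_inverse)
  then show ?thesis using rat_adjoin_closed(4)[OF int rat_adjoin_closed(6)[OF int]] by simp
qed

lemma field_embeddings_iff:
  "\<sigma> \<in> field_embeddings K \<longleftrightarrow> \<sigma> \<in> extensional K \<and> \<sigma> 1 = 1 \<and>
     (\<forall>g\<in>K. \<forall>h\<in>K. \<sigma> (g * h) = \<sigma> g * \<sigma> h \<and> \<sigma> (g + h) = \<sigma> g + \<sigma> h)"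
  by (auto simp: field_embeddings_def Ring.ring_hom_def ring_of_type_algebra_def)

text \<open>The class of the target type covers real and complex embeddings at once.\<close>

lemma field_embedding_Rats:
  fixes \<sigma> :: "real \<Rightarrow> 'b::real_normed_field"
  assumes \<sigma>: "\<sigma> \<in> field_embeddings K" and K: "\<rat> \<subseteq> K" and h: "h \<in> \<rat>"
  shows "\<sigma> h = of_real h"
proof -
  have add: "\<sigma> (g + h) = \<sigma> g + \<sigma> h" and mult: "\<sigma> (g * h) = \<sigma> g * \<sigma> h" if "g \<in> \<rat>" "h \<in> \<rat>" for g h
    using \<sigma> K that by (auto simp: field_embeddings_iff)
  have one: "\<sigma> 1 = 1" using \<sigma> by (simp add: field_embeddings_iff)
  have zero: "\<sigma> 0 = 0" using add[of 0 0] by simp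
  have nat: "\<sigma> (of_nat k) = of_nat k" for k
    by (induction k) (simp_all add: add one zero)
  have int: "\<sigma> (of_int k) = of_int k" for k
  proof (cases k)
    case (nonneg m)
    then show ?thesis using nat by simp
  next
    case (neg m)
    have "\<sigma> (of_int k) + \<sigma> (of_nat (Suc m)) = 0"
      using add[of "of_int k" "of_nat (Suc m)"] zero neg by simp
    then show ?thesis using neg nat[of "Suc m"] by (simp add: add_eq_0_iff2)
  qed
  obtain k m where km: "m > 0" "h = of_int k / of_int m"
    using h by (auto elim: Rats_cases')
  then have "of_int m * h = of_int k" by simp
  then have "of_int m * \<sigma> h = of_real (of_int m * h)"
    using mult[of "of_int m" h] int h by (metis Rats_of_int of_real_of_int_eq)
  then show ?thesis using km(1) by simp
qed

context consecutive_roots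
begin

lemma rat_adjoin_eq: "rat_adjoin {x * y, x * z} = biquad_field"
proof (intro subset_antisym subsetI)
  fix h assume "h \<in> rat_adjoin {x * y, x * z}"
  then show "h \<in> biquad_field" unfolding rat_adjoin_def
  proof (induction rule: generate_field.induct)
    case (m_inv h)
    then show ?case
      using biquad_field_inverse type_algebra_inverses(2)[of h] by (simp add: ring_of_type_algebra_def)
  next
    case (a_inv h)
    have "- 1 * h \<in> biquad_field"
      by (rule biquad_field_closed(2)[OF biquad_field_base(1) a_inv.IH]) simp
    then show ?case by (simp add: type_algebra_inverses)
  qed (auto simp: ring_of_type_algebra_def intro: biquad_field_base biquad_field_closed)
next
  fix h assume "h \<in> biquad_field"
  then obtain A B C D where h: "A \<in> \<rat>" "B \<in> \<rat>" "C \<in> \<rat>" "D \<in> \<rat>" "h = rat_comb x y z A B C D"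
    by (rule biquad_fieldE)
  \<comment> \<open>The third root comes from the two generators: yz = (xy)(xz)/x^2.\<close>
  have "h = A + B * (x * y) + C * (x * z) + D / (x * x) * ((x * y) * (x * z))"
    using pos by (simp add: h rat_comb_def field_simps)
  also have "\<dots> \<in> rat_adjoin {x * y, x * z}"
  proof -
    have Q: "A \<in> rat_adjoin {x * y, x * z}" "B \<in> rat_adjoin {x * y, x * z}" "C \<in> rat_adjoin {x * y, x * z}"
      "D / (x * x) \<in> rat_adjoin {x * y, x * z}"
      using h of_int_root_facts(1) by (simp_all add: rat_adjoin_Rats)
    have "x * y \<in> rat_adjoin {x * y, x * z}" "x * z \<in> rat_adjoin {x * y, x * z}"
      by (simp_all add: rat_adjoin_closed(2))
    with Q show ?thesis by (blast intro: rat_adjoin_closed(3,4))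
  qed
  finally show "h \<in> rat_adjoin {x * y, x * z}" .
qed

text \<open>The triple \<open>s\<close> holds the images of the roots. On the field the description
  has a unique solution because 1, xy, xz, yz are linearly independent.\<close>

definition conj_map :: "real \<times> real \<times> real \<Rightarrow> real \<Rightarrow> real" where
  "conj_map s h = (THE v. \<exists>A\<in>\<rat>. \<exists>B\<in>\<rat>. \<exists>C\<in>\<rat>. \<exists>D\<in>\<rat>. h = rat_comb x y z A B C D \<and>
     v = (case s of (x', y', z') \<Rightarrow> rat_comb x' y' z' A B C D))"

lemma conj_map_rat_comb:
  assumes "A \<in> \<rat>" "B \<in> \<rat>" "C \<in> \<rat>" "D \<in> \<rat>"
  shows "conj_map (x', y', z') (rat_comb x y z A B C D) = rat_comb x' y' z' A B C D"
  unfolding conj_map_def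
proof (rule the_equality)
  show "\<exists>A'\<in>\<rat>. \<exists>B'\<in>\<rat>. \<exists>C'\<in>\<rat>. \<exists>D'\<in>\<rat>. rat_comb x y z A B C D = rat_comb x y z A' B' C' D' \<and>
      rat_comb x' y' z' A B C D = (case (x', y', z') of (x', y', z') \<Rightarrow> rat_comb x' y' z' A' B' C' D')"
    using assms by auto
next
  fix v assume "\<exists>A'\<in>\<rat>. \<exists>B'\<in>\<rat>. \<exists>C'\<in>\<rat>. \<exists>D'\<in>\<rat>. rat_comb x y z A B C D = rat_comb x y z A' B' C' D' \<and>
      v = (case (x', y', z') of (x', y', z') \<Rightarrow> rat_comb x' y' z' A' B' C' D')"
  then show "v = rat_comb x' y' z' A B C D" using assms by (auto simp: rat_comb_eq_iff)
qed

text \<open>One representative of each pair of opposite sign patterns, as opposite patterns agree on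
  xy, xz and yz.\<close>

definition sign_choices :: "(real \<times> real \<times> real) set" where
  "sign_choices = {(x, y, z), (- x, y, z), (x, - y, z), (x, y, - z)}"

lemma sign_choices_squares:
  assumes "(x', y', z') \<in> sign_choices"
  shows "x' * x' = x * x" "y' * y' = y * y" "z' * z' = z * z"
  using assms by (auto simp: sign_choices_def)

lemma conj_map_hom:
  assumes "s \<in> sign_choices" "g \<in> biquad_field" "h \<in> biquad_field"
  shows "conj_map s (g + h) = conj_map s g + conj_map s h" "conj_map s (g * h) = conj_map s g * conj_map s h"
proof -
  obtain x' y' z' where s: "s = (x', y', z')" by (cases s)
  note sq = sign_choices_squares[OF assms(1)[unfolded s]]
  obtain A B C D where g: "A \<in> \<rat>" "B \<in> \<rat>" "C \<in> \<rat>" "D \<in> \<rat>" "g = rat_comb x y z A B C D"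
    using assms(2) by (rule biquad_fieldE)
  obtain A' B' C' D' where h: "A' \<in> \<rat>" "B' \<in> \<rat>" "C' \<in> \<rat>" "D' \<in> \<rat>" "h = rat_comb x y z A' B' C' D'"
    using assms(3) by (rule biquad_fieldE)
  show "conj_map s (g + h) = conj_map s g + conj_map s h"
    using g h by (simp add: s rat_comb_add conj_map_rat_comb)
  show "conj_map s (g * h) = conj_map s g * conj_map s h"
    unfolding g h s rat_comb_mult[OF refl refl refl]
    by (subst (1 2 3) conj_map_rat_comb)
      (use g h of_int_root_facts in \<open>simp_all add: rat_comb_mult[OF sq]\<close>)
qed

lemma conj_map_parts:
  "A \<in> \<rat> \<Longrightarrow> conj_map (x', y', z') A = A" "conj_map (x', y', z') (x * y) = x' * y'"
  "conj_map (x', y', z') (x * z) = x' * z'" "conj_map (x', y', z') (y * z) = y' * z'"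
  using conj_map_rat_comb[of A 0 0 0 x' y' z'] conj_map_rat_comb[of 0 1 0 0 x' y' z']
    conj_map_rat_comb[of 0 0 1 0 x' y' z'] conj_map_rat_comb[of 0 0 0 1 x' y' z']
  by (simp_all add: rat_comb_def)

definition embedding_of :: "real \<times> real \<times> real \<Rightarrow> real \<Rightarrow> 'b::real_normed_field" where
  "embedding_of s = (\<lambda>h\<in>biquad_field. of_real (conj_map s h))"

lemma embedding_of_inj: "inj_on (embedding_of :: _ \<Rightarrow> real \<Rightarrow> 'b::real_normed_field) sign_choices"
proof (rule inj_onI)
  fix s t assume st: "s \<in> sign_choices" "t \<in> sign_choices" "(embedding_of s :: real \<Rightarrow> 'b) = embedding_of t"
  have "of_real (conj_map s h) = (of_real (conj_map t h) :: 'b)" if "h \<in> biquad_field" for h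
    using fun_cong[OF st(3), of h] that by (simp add: embedding_of_def)
  then have "conj_map s (x * y) = conj_map t (x * y)" "conj_map s (x * z) = conj_map t (x * z)"
    using biquad_field_base by simp_all
  then show "s = t" using st(1,2) pos by (auto simp: sign_choices_def conj_map_parts)
qed

text \<open>An embedding sends xy and xz to themselves up to sign, and x^2 * yz = xy * xz then
  determines the image of yz. For complex targets this says that the field is totally real.\<close>

lemma field_embeddings_eq:
  "(field_embeddings biquad_field :: (real \<Rightarrow> 'b::real_normed_field) set) = embedding_of ` sign_choices"
proof (intro subset_antisym subsetI)
  fix \<sigma> :: "real \<Rightarrow> 'b" assume "\<sigma> \<in> embedding_of ` sign_choices"
  then obtain s where s: "s \<in> sign_choices" "\<sigma> = embedding_of s" by auto
  have "conj_map s 1 = 1" using conj_map_parts(1)[of 1] by (cases s) simp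
  then show "\<sigma> \<in> field_embeddings biquad_field"
    using s biquad_field_closed biquad_field_base(1)[of 1] conj_map_hom[OF s(1)]
    by (auto simp: field_embeddings_iff embedding_of_def)
next
  fix \<sigma> :: "real \<Rightarrow> 'b" assume \<sigma>: "\<sigma> \<in> field_embeddings biquad_field"
  have add: "\<sigma> (g + h) = \<sigma> g + \<sigma> h" and mult: "\<sigma> (g * h) = \<sigma> g * \<sigma> h"
    if "g \<in> biquad_field" "h \<in> biquad_field" for g h
    using \<sigma> that by (auto simp: field_embeddings_iff)
  have Q: "\<sigma> h = of_real h" if "h \<in> \<rat>" for h
    using field_embedding_Rats[OF \<sigma> _ that] biquad_field_base(1) by blast
  have root: "\<sigma> t = of_real t \<or> \<sigma> t = of_real (- t)" if "t \<in> biquad_field" "t * t \<in> \<rat>" for t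
  proof -
    have "\<sigma> t * \<sigma> t = of_real t * of_real t" using mult[OF that(1,1)] Q[OF that(2)] by simp
    then show ?thesis by (simp add: square_eq_iff)
  qed
  have xyz_sq: "(x * y) * (x * y) \<in> \<rat>" "(x * z) * (x * z) \<in> \<rat>"
    using Rats_mult[OF of_int_root_facts(1,2)] Rats_mult[OF of_int_root_facts(1,3)] by (simp_all add: mult_ac)
  have "\<exists>(x', y', z') \<in> sign_choices. \<sigma> (x * y) = of_real (x' * y') \<and> \<sigma> (x * z) = of_real (x' * z')"
    using root[OF biquad_field_base(2) xyz_sq(1)] root[OF biquad_field_base(3) xyz_sq(2)]
    by (auto simp: sign_choices_def)
  then obtain x' y' z' where s: "(x', y', z') \<in> sign_choices" "\<sigma> (x * y) = of_real (x' * y')" "\<sigma> (x * z) = of_real (x' * z')"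
    by auto
  have "\<sigma> (x * x) * \<sigma> (y * z) = \<sigma> (x * y) * \<sigma> (x * z)"
    using mult[of "x * x" "y * z"] mult[of "x * y" "x * z"] biquad_field_base of_int_root_facts by (simp add: mult_ac)
  then have "of_real (x * x) * \<sigma> (y * z) = of_real ((x' * x') * (y' * z'))"
    using Q[OF of_int_root_facts(1)] s(2,3) by (simp add: mult_ac)
  then have yz: "\<sigma> (y * z) = of_real (y' * z')"
    using sign_choices_squares(1)[OF s(1)] of_int_root_facts(4) by simp
  have "\<sigma> h = embedding_of (x', y', z') h" for h
  proof (cases "h \<in> biquad_field")
    case True
    then obtain A B C D where h: "A \<in> \<rat>" "B \<in> \<rat>" "C \<in> \<rat>" "D \<in> \<rat>" "h = rat_comb x y z A B C D"
      by (rule biquad_fieldE)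
    have "\<sigma> h = of_real A + of_real B * \<sigma> (x * y) + of_real C * \<sigma> (x * z) + of_real D * \<sigma> (y * z)"
      unfolding h rat_comb_def using h biquad_field_base biquad_field_closed by (simp add: add mult Q)
    also have "\<dots> = of_real (rat_comb x' y' z' A B C D)"
      by (simp add: s(2,3) yz rat_comb_def)
    finally show ?thesis using True h by (simp add: embedding_of_def conj_map_rat_comb)
  next
    case False
    then show ?thesis using \<sigma> by (auto simp: field_embeddings_iff embedding_of_def extensional_def)
  qed
  then have "\<sigma> = embedding_of (x', y', z')" by auto
  then show "\<sigma> \<in> embedding_of ` sign_choices" using s(1) by auto
qed

end

section \<open>Integral elements and the transfer to the twisted signature\<close>

lemma square_sum_dvd_4:
  fixes u v :: int
  assumes "4 dvd u\<^sup>2 + v\<^sup>2"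
  shows "even u" "even v"
proof -
  have sq: "t\<^sup>2 mod 4 = t mod 2" for t :: int
  proof (cases "even t")
    case True
    then obtain s where "t = 2 * s" by (rule evenE)
    then show ?thesis by (simp add: power2_eq_square)
  next
    case False
    then obtain s where "t = 2 * s + 1" by (rule oddE)
    then have "t\<^sup>2 = 4 * (s\<^sup>2 + s) + 1" by (simp add: power2_eq_square algebra_simps)
    then have "t\<^sup>2 mod 4 = 1" by presburger
    then show ?thesis using False by (simp add: odd_iff_mod_2_eq_one)
  qed
  have "(u\<^sup>2 mod 4 + v\<^sup>2 mod 4) mod 4 = 0" using assms by (simp add: mod_add_eq)
  then have "(u mod 2 + v mod 2) mod 4 = 0" by (simp only: sq)
  then have "u mod 2 = 0 \<and> v mod 2 = 0" by presburger
  then show "even u" "even v" by presburger+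
qed

lemma square_diff_dvd_4:
  fixes u v :: int
  assumes "4 dvd u\<^sup>2 - v\<^sup>2"
  shows "even u \<longleftrightarrow> even v"
proof -
  have "even (u\<^sup>2 - v\<^sup>2)" using assms by presburger
  then show ?thesis by simp
qed

text \<open>The square of the reduced denominator of \<open>t\<close> divides
  \<open>d\<close>.\<close>

lemma squarefree_rat_square:
  fixes d N :: int and t :: real
  assumes "squarefree d" "t \<in> \<rat>" "of_int d * t\<^sup>2 = of_int N"
  shows "t \<in> \<int>"
proof -
  obtain k m where km: "m > 0" "coprime k m" "t = of_int k / of_int m"
    using assms(2) by (auto elim: Rats_cases')
  have "real_of_int (d * k\<^sup>2) = real_of_int (N * m\<^sup>2)"
    using assms(3) km(1) by (simp add: km(3) power_divide field_simps)
  then have "d * k\<^sup>2 = N * m\<^sup>2" by (simp only: of_int_eq_iff)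
  then have "m\<^sup>2 dvd d * k\<^sup>2" by simp
  moreover have "coprime (m\<^sup>2) (k\<^sup>2)" using km(2) by (simp add: coprime_commute)
  ultimately have "m\<^sup>2 dvd d" by (simp add: coprime_dvd_mult_left_iff)
  then have "m dvd 1" using assms(1) by (simp add: squarefree_def)
  then have "m = 1" using km(1) by simp
  then show ?thesis using km(3) by simp
qed

text \<open>Meant for 2A + 2B sqrt d, the relative trace of an integer to a quadratic subfield: the
  two integrality hypotheses are its trace and norm.\<close>

lemma quadratic_integer_coords:
  fixes A B :: real and d :: int
  assumes "squarefree d" "A \<in> \<rat>" "B \<in> \<rat>" "4 * A \<in> \<int>" "4 * A\<^sup>2 - 4 * of_int d * B\<^sup>2 \<in> \<int>"
  obtains U V :: int where "4 * A = of_int U" "4 * B = of_int V" "4 dvd U\<^sup>2 - d * V\<^sup>2"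
proof -
  obtain U where U: "4 * A = of_int U" using assms(4) by (auto elim: Ints_cases)
  obtain M where M: "4 * A\<^sup>2 - 4 * of_int d * B\<^sup>2 = of_int M" using assms(5) by (auto elim: Ints_cases)
  have "(4 * A)\<^sup>2 = (of_int U)\<^sup>2" by (simp only: U)
  then have eq: "of_int d * (4 * B)\<^sup>2 = of_int (U\<^sup>2 - 4 * M)"
    using M by (simp add: power_mult_distrib)
  then have "4 * B \<in> \<int>"
    using assms(3) by (intro squarefree_rat_square[OF assms(1) _ eq]) simp
  then obtain V where V: "4 * B = of_int V" by (auto elim: Ints_cases)
  have "real_of_int (d * V\<^sup>2) = real_of_int (U\<^sup>2 - 4 * M)" using eq by (simp add: V)
  then have "d * V\<^sup>2 = U\<^sup>2 - 4 * M" by (simp only: of_int_eq_iff)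
  then show ?thesis using that[OF U V] by simp
qed

text \<open>Multiplication and division by \<open>\<eta> = (x+y)(y+z)/2\<close>.\<close>
fun mul_eta :: "int \<Rightarrow> quad \<Rightarrow> quad" where
  "mul_eta n (i, j, m, k) =
     (i + (2*n-1)*j + (2*n+1)*(m+k), i + 2*n*j + (2*n+1)*m, i + 2*n*j + (2*n+1)*m + k, - m - j)"

fun div_eta :: "int \<Rightarrow> quad \<Rightarrow> quad" where
  "div_eta n (i, j, m, k) =
     ((2*n+1)*(m+k) - i - (2*n-1)*j, (2*n+1)*m - i - 2*n*j, i + 2*n*j - (2*n+1)*m - k, m - j)"

lemma mul_eta_props:
  "mul_eta n (div_eta n w) = w" "mul_eta n (u + v) = mul_eta n u + mul_eta n v"
  by (cases w; simp add: algebra_simps power2_eq_square) (cases u; cases v; simp add: algebra_simps)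

text \<open>The inverse of \<open>\<eta>\<close> is (y-x)(z-y)/2, because (y^2 - x^2)(z^2 - y^2) =
  4.\<close>

lemma conj_val_eta:
  assumes "x * x = 2 * of_int n - 1" "y * y = 2 * of_int n + 1" "z * z = 2 * of_int n + 3"
  shows "conj_val x y z (mul_eta n w) = (x + y) * (y + z) / 2 * conj_val x y z w"
    and "conj_val x y z (div_eta n w) = (y - x) * (z - y) / 2 * conj_val x y z w"
  by (cases w; simp add: conj_val_def square_rules[OF assms] field_simps power2_eq_square)+

context consecutive_roots
begin

lemma conj_val_eq_rat_comb:
  assumes "x' * x' = x * x"
  shows "conj_val x' y' z' (i, j, m, k) = rat_comb x' y' z' (of_int i + of_int j * (2 * of_int n - 1) / 2)
    (of_int (m - k) / 2) (of_int j / 2) (of_int (m + k) / 2)"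
proof -
  have "conj_val x' y' z' (i, j, m, k) = (2 * of_int i + of_int j * (2 * of_int n - 1) +
      of_int (m - k) * (x' * y') + of_int j * (x' * z') + of_int (m + k) * (y' * z')) / 2"
    unfolding conj_val_def prod.case assms squares(1) by (simp add: algebra_simps)
  then show ?thesis
    by (simp only: rat_comb_def add_divide_distrib times_divide_eq_left)
qed

lemma conj_val_in_field: "conj_val x y z w \<in> biquad_field"
proof (cases w)
  case (fields i j m k)
  show ?thesis unfolding fields conj_val_eq_rat_comb[OF refl] by (rule biquad_fieldI) simp_all
qed

lemma conj_map_conj_val:
  assumes "(x', y', z') \<in> sign_choices"
  shows "conj_map (x', y', z') (conj_val x y z w) = conj_val x' y' z' w"
proof (cases w)
  case (fields i j m k)
  show ?thesis
    unfolding fields conj_val_eq_rat_comb[OF refl] conj_val_eq_rat_comb[OF sign_choices_squares(1)[OF assms]]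
    by (rule conj_map_rat_comb) simp_all
qed

lemma algebraic_int_conj_val: "algebraic_int (conj_val x y z w)"
proof (cases w)
  case (fields i j m k)
  define \<omega> \<theta> where "\<omega> = (x * x + x * z) / 2" and "\<theta> = y * (x + z) / 2"
  have root: "algebraic_int t" if "algebraic_int (t * t)" for t :: real
    using that by (rule algebraic_int_root[of _ "[:0, 0, 1:]"]) (auto simp: coeff_pCons split: nat.splits)
  have "poly [:- of_int (2*n-1), - of_int (2*n-1), 1:] \<omega> = 0"
    by (simp add: \<omega>_def field_simps square_rules[OF squares])
  then have \<omega>: "algebraic_int \<omega>"
    by (rule algebraic_int.intros[rotated 2]) (auto simp: coeff_pCons split: nat.splits)
  have "\<theta> * \<theta> = of_int (2*n+1) * (\<omega> + 1)"
    by (simp add: \<theta>_def \<omega>_def field_simps square_rules[OF squares])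
  moreover have "algebraic_int (of_int (2*n+1) * (\<omega> + 1))"
    by (intro algebraic_int_mult algebraic_int_add algebraic_int_of_int algebraic_int_1 \<omega>)
  ultimately have \<theta>: "algebraic_int \<theta>" by (metis root)
  have "(x * y) * (x * y) = of_int ((2*n-1) * (2*n+1))"
    by (simp add: field_simps square_rules[OF squares])
  then have xy: "algebraic_int (x * y)" by (metis root algebraic_int_of_int)
  have "conj_val x y z w = of_int i + of_int j * \<omega> + of_int m * \<theta> + of_int k * (\<theta> - x * y)"
    by (simp add: fields conj_val_def \<omega>_def \<theta>_def field_simps)
  also have "algebraic_int \<dots>"
    by (intro algebraic_int_add algebraic_int_mult algebraic_int_diff algebraic_int_of_int \<omega> \<theta> xy)
  finally show ?thesis .
qed

lemma algebraic_int_conj_map: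
  assumes s: "s \<in> sign_choices" and h: "h \<in> biquad_field" "algebraic_int h"
  shows "algebraic_int (conj_map s h)"
proof -
  have Q: "conj_map s A = A" if "A \<in> \<rat>" for A using that by (cases s) (simp add: conj_map_parts)
  have pow: "h ^ i \<in> biquad_field \<and> conj_map s (h ^ i) = conj_map s h ^ i" for i
    by (induction i) (use Q biquad_field_base(1)[of 1] biquad_field_closed(2)[OF h(1)] conj_map_hom(2)[OF s h(1)] in auto)
  have sum: "(\<Sum>i\<in>I. of_int (c i) * h ^ i) \<in> biquad_field \<and>
      conj_map s (\<Sum>i\<in>I. of_int (c i) * h ^ i) = (\<Sum>i\<in>I. of_int (c i) * conj_map s h ^ i)"
    if "finite I" for I :: "nat set" and c :: "nat \<Rightarrow> int"
    using that
  proof (induction I rule: finite_induct)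
    case empty
    then show ?case using Q[of 0] biquad_field_base(1)[of 0] by simp
  next
    case (insert i I)
    have "of_int (c i) * h ^ i \<in> biquad_field"
      "conj_map s (of_int (c i) * h ^ i) = of_int (c i) * conj_map s h ^ i"
      using biquad_field_closed(2)[of "of_int (c i)" "h ^ i"] conj_map_hom(2)[OF s, of "of_int (c i)" "h ^ i"]
        biquad_field_base(1)[of "of_int (c i)"] Q[of "of_int (c i)"] pow[of i] by simp_all
    then show ?case
      using insert biquad_field_closed(1) conj_map_hom(1)[OF s] by simp
  qed
  obtain p where p: "poly (map_poly of_int p) h = 0" "lead_coeff p = 1"
    using h(2) by (auto simp: algebraic_int_altdef_ipoly)
  have "conj_map s 0 = poly (map_poly of_int p) (conj_map s h)"
    using p(1) sum[of "{..degree p}" "coeff p"] by (simp add: poly_altdef)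
  then show ?thesis using p(2) Q[of 0] unfolding algebraic_int_altdef_ipoly by auto
qed

text \<open>The relative traces bound the denominators: p and r are 3 and q is 1 modulo 4, so four
  times each coefficient is an even integer. The relative norm to Q(xz) supplies the remaining
  parity conditions, which cut out exactly the lattice of \<open>conj_val\<close>.\<close>

lemma integer_eq_conj_val:
  assumes sf: "squarefree ((2*n-1) * (2*n+1))" "squarefree ((2*n-1) * (2*n+3))" "squarefree ((2*n+1) * (2*n+3))"
    and h: "h \<in> biquad_field" "algebraic_int h"
  obtains w where "h = conj_val x y z w"
proof -
  obtain A B C D where Q: "A \<in> \<rat>" "B \<in> \<rat>" "C \<in> \<rat>" "D \<in> \<rat>" and hc: "h = rat_comb x y z A B C D"
    using h(1) by (rule biquad_fieldE)
  define h1 h2 h3 h4 where "h1 = rat_comb x y z A B C D" and "h2 = rat_comb x y z A (- B) (- C) D"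
    and "h3 = rat_comb x y z A (- B) C (- D)" and "h4 = rat_comb x y z A B (- C) (- D)"
  have "h1 = conj_map (x, y, z) h" "h2 = conj_map (- x, y, z) h" "h3 = conj_map (x, - y, z) h" "h4 = conj_map (x, y, - z) h"
    using Q by (simp_all add: hc conj_map_rat_comb h1_def h2_def h3_def h4_def) (simp_all add: rat_comb_def)
  then have ai: "algebraic_int h1" "algebraic_int h2" "algebraic_int h3" "algebraic_int h4"
    using algebraic_int_conj_map[OF _ h] by (simp_all add: sign_choices_def)
  note ai_ops = algebraic_int_add algebraic_int_mult ai
  have "algebraic_int ((h1 + h2) + (h3 + h4))" by (intro ai_ops)
  moreover have "(h1 + h2) + (h3 + h4) = 4 * A"
    by (simp add: h1_def h2_def h3_def h4_def rat_comb_def)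
  ultimately have A4: "4 * A \<in> \<int>" using Q(1) by (intro rational_algebraic_int_is_int) simp_all
  have "algebraic_int ((h1 + h4) * (h2 + h3))" "algebraic_int ((h1 + h3) * (h2 + h4))" "algebraic_int ((h1 + h2) * (h3 + h4))"
    by (intro ai_ops)+
  moreover have "(h1 + h4) * (h2 + h3) = 4 * A\<^sup>2 - 4 * of_int ((2*n-1) * (2*n+1)) * B\<^sup>2"
    "(h1 + h3) * (h2 + h4) = 4 * A\<^sup>2 - 4 * of_int ((2*n-1) * (2*n+3)) * C\<^sup>2"
    "(h1 + h2) * (h3 + h4) = 4 * A\<^sup>2 - 4 * of_int ((2*n+1) * (2*n+3)) * D\<^sup>2"
    by (simp_all add: h1_def h2_def h3_def h4_def rat_comb_def algebra_simps power2_eq_square square_rules[OF squares])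
  ultimately have norms: "4 * A\<^sup>2 - 4 * of_int ((2*n-1) * (2*n+1)) * B\<^sup>2 \<in> \<int>"
    "4 * A\<^sup>2 - 4 * of_int ((2*n-1) * (2*n+3)) * C\<^sup>2 \<in> \<int>"
    "4 * A\<^sup>2 - 4 * of_int ((2*n+1) * (2*n+3)) * D\<^sup>2 \<in> \<int>"
    using Q by (auto intro!: rational_algebraic_int_is_int)
  obtain U V where p: "4 * A = of_int U" "4 * B = of_int V" "4 dvd U\<^sup>2 - (2*n-1) * (2*n+1) * V\<^sup>2"
    using quadratic_integer_coords[OF sf(1) Q(1,2) A4 norms(1)] by metis
  obtain U' V' where q: "4 * A = of_int U'" "4 * C = of_int V'" "4 dvd U'\<^sup>2 - (2*n-1) * (2*n+3) * V'\<^sup>2"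
    using quadratic_integer_coords[OF sf(2) Q(1,3) A4 norms(2)] by metis
  obtain U'' V'' where r: "4 * A = of_int U''" "4 * D = of_int V''" "4 dvd U''\<^sup>2 - (2*n+1) * (2*n+3) * V''\<^sup>2"
    using quadratic_integer_coords[OF sf(3) Q(1,4) A4 norms(3)] by metis
  have U: "U' = U" "U'' = U" using p(1) q(1) r(1) by simp_all
  have "U\<^sup>2 + V\<^sup>2 = (U\<^sup>2 - (2*n-1) * (2*n+1) * V\<^sup>2) + 4 * (n\<^sup>2 * V\<^sup>2)"
    by (simp add: algebra_simps power2_eq_square)
  then have "4 dvd U\<^sup>2 + V\<^sup>2" using p(3) by (metis dvd_add dvd_triv_left)
  then have UV: "even U" "even V" by (rule square_sum_dvd_4)+
  have "U\<^sup>2 + V''\<^sup>2 = (U\<^sup>2 - (2*n+1) * (2*n+3) * V''\<^sup>2) + 4 * ((n\<^sup>2 + 2 * n + 1) * V''\<^sup>2)"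
    by (simp add: algebra_simps power2_eq_square)
  then have "4 dvd U\<^sup>2 + V''\<^sup>2" using r(3) U by (metis dvd_add dvd_triv_left)
  then have V'': "even V''" by (rule square_sum_dvd_4)
  have "U\<^sup>2 - V'\<^sup>2 = (U\<^sup>2 - (2*n-1) * (2*n+3) * V'\<^sup>2) + 4 * ((n\<^sup>2 + n - 1) * V'\<^sup>2)"
    by (simp add: algebra_simps power2_eq_square)
  then have "4 dvd U\<^sup>2 - V'\<^sup>2" using q(3) U by (metis dvd_add dvd_triv_left)
  then have V': "even V'" using UV(1) square_diff_dvd_4 by blast
  obtain A' B' C' D' where "U = 2 * A'" "V = 2 * B'" "V' = 2 * C'" "V'' = 2 * D'"
    using UV V' V'' by (auto elim!: evenE)
  then have ABCD: "A = of_int A' / 2" "B = of_int B' / 2" "C = of_int C' / 2" "D = of_int D' / 2"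
    using p q r by simp_all

  \<comment> \<open>G + H xz is the relative norm to Q(xz). Its integrality makes 2G and 2H integers
    of equal parity, since q is 1 modulo 4.\<close>
  define G H where "G = A\<^sup>2 + of_int ((2*n-1) * (2*n+3)) * C\<^sup>2 - of_int ((2*n+1) * (2*n+3)) * D\<^sup>2 - of_int ((2*n-1) * (2*n+1)) * B\<^sup>2"
    and "H = 2 * (A * C - of_int (2*n+1) * (B * D))"
  have prods: "h1 * h3 = G + H * (x * z)" "h2 * h4 = G - H * (x * z)"
    by (simp_all add: h1_def h2_def h3_def h4_def G_def H_def rat_comb_def algebra_simps power2_eq_square square_rules[OF squares])
  have "algebraic_int (h1 * h3 + h2 * h4)" "algebraic_int ((h1 * h3) * (h2 * h4))" by (intro ai_ops)+
  moreover have "h1 * h3 + h2 * h4 = 2 * G" "(h1 * h3) * (h2 * h4) = G\<^sup>2 - of_int ((2*n-1) * (2*n+3)) * H\<^sup>2"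
    unfolding prods by (simp_all add: algebra_simps power2_eq_square square_rules[OF squares])
  moreover have "2 * G \<in> \<rat>" "G\<^sup>2 - of_int ((2*n-1) * (2*n+3)) * H\<^sup>2 \<in> \<rat>"
    using Q by (simp_all add: G_def H_def)
  ultimately have "2 * G \<in> \<int>" "G\<^sup>2 - of_int ((2*n-1) * (2*n+3)) * H\<^sup>2 \<in> \<int>"
    using rational_algebraic_int_is_int by metis+
  then obtain g M where gM: "2 * G = of_int g" "G\<^sup>2 - of_int ((2*n-1) * (2*n+3)) * H\<^sup>2 = of_int M"
    by (auto elim!: Ints_cases)
  define k where "k = A' * C' - (2*n+1) * (B' * D')"
  have Hk: "2 * H = of_int k" by (simp add: H_def k_def ABCD field_simps)
  have "4 * (G\<^sup>2 - of_int ((2*n-1) * (2*n+3)) * H\<^sup>2) = (2 * G)\<^sup>2 - of_int ((2*n-1) * (2*n+3)) * (2 * H)\<^sup>2"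
    by (simp add: power_mult_distrib algebra_simps)
  then have "real_of_int (4 * M) = real_of_int (g\<^sup>2 - (2*n-1) * (2*n+3) * k\<^sup>2)"
    unfolding gM Hk by simp
  then have "4 * M = g\<^sup>2 - (2*n-1) * (2*n+3) * k\<^sup>2" by (simp only: of_int_eq_iff)
  then have "g\<^sup>2 - k\<^sup>2 = 4 * (M + (n\<^sup>2 + n - 1) * k\<^sup>2)" by (simp add: algebra_simps power2_eq_square)
  then have "even g \<longleftrightarrow> even k" by (intro square_diff_dvd_4) simp
  then have "even (g - k)" by simp
  then obtain e where "g - k = 2 * e" by (rule evenE)
  then have e: "g = k + 2 * e" by simp
  have "2 * (2 * G) = (2 * A)\<^sup>2 + of_int ((2*n-1) * (2*n+3)) * (2 * C)\<^sup>2 -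
      of_int ((2*n+1) * (2*n+3)) * (2 * D)\<^sup>2 - of_int ((2*n-1) * (2*n+1)) * (2 * B)\<^sup>2"
    by (simp add: G_def power_mult_distrib)
  moreover have "2 * A = of_int A'" "2 * B = of_int B'" "2 * C = of_int C'" "2 * D = of_int D'"
    by (simp_all add: ABCD)
  ultimately have "real_of_int (A'\<^sup>2 + (2*n-1) * (2*n+3) * C'\<^sup>2 - (2*n+1) * (2*n+3) * D'\<^sup>2 -
      (2*n-1) * (2*n+1) * B'\<^sup>2) = real_of_int (2 * g)"
    unfolding gM by simp
  then have "A'\<^sup>2 + (2*n-1) * (2*n+3) * C'\<^sup>2 - (2*n+1) * (2*n+3) * D'\<^sup>2 - (2*n-1) * (2*n+1) * B'\<^sup>2 = 2 * g"
    by (simp only: of_int_eq_iff)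
  \<comment> \<open>Modulo 4, 2g may be replaced by 2k, whose mixed terms complete the two
    squares.\<close>
  then have "(A' - C')\<^sup>2 + (B' + D')\<^sup>2 = 4 * (e - n * (B' * D') - (n\<^sup>2 + n - 1) * C'\<^sup>2 + (n\<^sup>2 + 2 * n + 1) * D'\<^sup>2 + n\<^sup>2 * B'\<^sup>2)"
    unfolding e k_def by (simp add: algebra_simps power2_eq_square)
  then have "4 dvd (A' - C')\<^sup>2 + (B' + D')\<^sup>2" by simp
  then have "even (A' - C')" "even (B' + D')" by (rule square_sum_dvd_4)+
  then have "even (A' - (2*n-1) * C')" "even (B' + D')" "even (D' - B')" by auto
  then obtain i m l where "A' - (2*n-1) * C' = 2 * i" "B' + D' = 2 * m" "D' - B' = 2 * l"
    by (metis dvdE)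
  then have parts: "A' = 2 * i + (2*n-1) * C'" "B' = m - l" "D' = m + l" by simp_all
  have "h = conj_val x y z (i, C', m, l)"
    unfolding hc ABCD conj_val_eq_rat_comb[OF refl] parts
    by (simp add: add_divide_distrib mult.commute)
  then show ?thesis by (rule that)
qed

section \<open>Transfer from total positivity to the twisted signature\<close>

lemma totally_positive_iff:
  "conj_val x y z w \<in> totally_positive_integers biquad_field \<longleftrightarrow>
     (\<forall>(x', y', z') \<in> sign_choices. 0 < conj_val x' y' z' w)"
proof -
  have "conj_val x y z w \<in> ring_of_integers biquad_field"
    by (simp add: ring_of_integers_def conj_val_in_field algebraic_int_conj_val)
  then show ?thesis
    by (auto simp: totally_positive_integers_def field_embeddings_eq embedding_of_def conj_val_in_field conj_map_conj_val)
qed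

lemma field_norm_conj_val: "field_norm biquad_field (conj_val x y z w) = quad_norm x y z w"
proof -
  have "(\<Prod>\<sigma> \<in> field_embeddings biquad_field. \<sigma> (conj_val x y z w)) =
      (\<Prod>s \<in> sign_choices. (embedding_of s :: real \<Rightarrow> complex) (conj_val x y z w))"
    unfolding field_embeddings_eq by (rule prod.reindex[OF embedding_of_inj, unfolded o_def])
  also have "\<dots> = complex_of_real (\<Prod>(x', y', z') \<in> sign_choices. conj_val x' y' z' w)"
    by (auto simp: embedding_of_def conj_val_in_field conj_map_conj_val intro!: prod.cong)
  also have "(\<Prod>(x', y', z') \<in> sign_choices. conj_val x' y' z' w) = quad_norm x y z w"
    using pos by (simp add: sign_choices_def quad_norm_def mult.assoc)
  finally show ?thesis by (simp add: field_norm_def)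
qed

lemmas eta_signs = conj_val_eta[OF squares] conj_val_eta[OF squares_neg(1) squares(2,3)]
  conj_val_eta[OF squares(1) squares_neg(2) squares(3)] conj_val_eta[OF squares(1,2) squares_neg(3)]

lemma sig_pos_div_eta:
  assumes "\<forall>(x', y', z') \<in> sign_choices. 0 < conj_val x' y' z' w"
  shows "sig_pos (div_eta n w)"
proof -
  have "0 < (y - x) * (z - y) / 2" "0 < (y - - x) * (z - y) / 2"
    "(- y - x) * (z - - y) / 2 < 0" "(y - x) * (- z - y) / 2 < 0"
    using pos less by (simp_all add: mult_neg_pos mult_pos_neg)
  then show ?thesis
    using assms unfolding sig_pos_def eta_signs sign_choices_def by (simp add: mult_neg_pos)
qed

lemma mul_eta_totally_positive:
  assumes "sig_pos w"
  shows "\<forall>(x', y', z') \<in> sign_choices. 0 < conj_val x' y' z' (mul_eta n w)"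
proof -
  have "0 < (x + y) * (y + z) / 2" "0 < (- x + y) * (y + z) / 2"
    "(x + - y) * (- y + z) / 2 < 0" "(x + y) * (y + - z) / 2 < 0"
    using pos less by (simp_all add: mult_neg_pos mult_pos_neg)
  then show ?thesis
    using assms unfolding sig_pos_def sign_choices_def by (simp add: eta_signs mult_neg_neg)
qed

lemma quad_norm_div_eta: "quad_norm x y z (div_eta n w) = quad_norm x y z w"
proof -
  have mult: "(s * A) * (t * B) * (u * C) * (v * D) = (s * t * u * v) * (A * B * C * D)"
    for s t u v A B C D :: real
    by simp
  have neg: "y - - x = y + x" "- y - x = - (y + x)" "z - - y = z + y" "- z - y = - (z + y)"
    by simp_all
  have two: "(y - x) * (y + x) = 2" "(z - y) * (z + y) = 2"
    by (simp_all add: squares algebra_simps)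
  have "s * u / 2 * (t * u / 2) * (- t * v / 2) * (s * - v / 2) = (s * t) * (s * t) * ((u * v) * (u * v)) / 16"
    for s t u v :: real by simp
  note factors = this[of "y - x" "z - y" "y + x" "z + y", unfolded two]
  show ?thesis
    unfolding quad_norm_def eta_signs neg mult factors by simp
qed

text \<open>Multiplication by \<open>\<eta>\<close> carries a splitting in the twisted signature
  back to a splitting into totally positive integers.\<close>

lemma indecomposable_norm_le:
  assumes sf: "squarefree ((2*n-1) * (2*n+1))" "squarefree ((2*n-1) * (2*n+3))" "squarefree ((2*n+1) * (2*n+3))"
    and ind: "indecomposable biquad_field \<alpha>"
  shows "field_norm biquad_field \<alpha> \<le> norm_bound"
proof -
  have \<alpha>: "\<alpha> \<in> totally_positive_integers biquad_field"
    using ind by (simp add: indecomposable_def)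
  then have "\<alpha> \<in> biquad_field" "algebraic_int \<alpha>"
    by (simp_all add: totally_positive_integers_def ring_of_integers_def)
  then obtain w where w: "\<alpha> = conj_val x y z w"
    using integer_eq_conj_val[OF sf] by metis
  have "sig_pos (div_eta n w)"
    using \<alpha> totally_positive_iff sig_pos_div_eta by (simp add: w)
  moreover have False if "sig_pos u" "sig_pos v" "div_eta n w = u + v" for u v
  proof -
    have "w = mul_eta n u + mul_eta n v"
      using mul_eta_props that(3) by metis
    then have "\<alpha> = conj_val x y z (mul_eta n u) + conj_val x y z (mul_eta n v)"
      by (simp add: w conj_val_add)
    then show False
      using ind that(1,2) mul_eta_totally_positive totally_positive_iff unfolding indecomposable_def by blast
  qed
  ultimately have "sig_indec (div_eta n w)" unfolding sig_indec_def by blast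
  then show ?thesis
    using sig_indec_norm_le quad_norm_div_eta by (metis w field_norm_conj_val)
qed

end

theorem theorem1p3:
  fixes n p q r :: int and K :: "real set" and \<alpha> :: real
  assumes "n \<ge> 6"
    and "p = (2*n - 1) * (2*n + 1)"
    and "q = (2*n - 1) * (2*n + 3)"
    and "r = (2*n + 1) * (2*n + 3)"
    and "squarefree p" and "squarefree q" and "squarefree r"
    and "K = rat_adjoin {sqrt (of_int p), sqrt (of_int q)}"
    and "\<alpha> \<in> totally_positive_integers K"
    and "indecomposable K \<alpha>"
  shows "field_norm K \<alpha> \<le> of_int (16*n^4 + 64*n^3 + 16*n^2 - 96*n + 36)"
proof -
  define x y z where "x = sqrt (of_int (2*n - 1))" and "y = sqrt (of_int (2*n + 1))" and "z = sqrt (of_int (2*n + 3))"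
  interpret consecutive_roots n x y z
    by unfold_locales (use assms(1) in \<open>simp_all add: x_def y_def z_def\<close>)
  have "sqrt (of_int p) = x * y" "sqrt (of_int q) = x * z"
    by (simp_all only: assms(2,3) x_def y_def z_def of_int_mult real_sqrt_mult)
  then have K: "K = biquad_field" using assms(8) rat_adjoin_eq by simp
  have "field_norm K \<alpha> \<le> norm_bound"
    using indecomposable_norm_le assms(2-7,10) unfolding K by simp
  \<comment> \<open>Both sides are the square of 4n^2 + 8n - 6.\<close>
  also have "norm_bound = of_int (16*n^4 + 64*n^3 + 16*n^2 - 96*n + 36)"
    by (simp add: power2_eq_square power3_eq_cube power4_eq_xxxx algebra_simps)
  finally show ?thesis .
qed

end
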